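(* Let $p$ be a prime and let $G$ be a $p$-extraspecial group of order $p^{2n+1}$. Then $$\mathrm{AM}_{\mathrm Z}(G) = 1 + 2\left(1-\frac{1}{p^{2n}}\right)\left(1-\frac1p\right).$$
   Context: For a prime $p$, a finite group $G$ is $p$-extraspecial if it has order $p^{2n+1}$ for some integer $n$ and: (i) the centre $Z(G)$ and the derived subgroup $G'$ both have order $p$; (ii) the quotient $G/Z(G)$ is abelian, and each non-identity element of this quotient has order $p$. All characters are complex characters. For a finite group $G$: $\mathrm{Irr}(G)$ is the set of irreducible characters of $G$, $d_\chi$ is the degree of $\chi$, $\mathrm{Conj}(G)$ is the set of conjugacy classes of $G$, and $\chi(C)$ is the common value of $\chi$ on the elements of a conjugacy class $C$. The ZL-amenability constant of a finite group $G$ (the amenability constant of the centre of $\ell^1(G)$) is $$\mathrm{AM}_{\mathrm Z}(G) = \frac{1}{|G|^2}\sum_{C,D\in \mathrm{Conj}(G)} \left| \sum_{\chi\in \mathrm{Irr}(G)} d_\chi^2\, \chi(C)\overline{\chi(D)} \right| \, |C|\,|D|.$$ *)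

theory Defs
  imports
    "HOL-Algebra.Generated_Groups"
    "HOL-Algebra.Group_Action"
    "HOL-Algebra.Multiplicative_Group"
    "HOL-Computational_Algebra.Primes"
    "Jordan_Normal_Form.VS_Connect"
begin

section \<open>Extraspecial groups\<close>

definition group_center :: "('a, 'b) monoid_scheme \<Rightarrow> 'a set" where
  "group_center G =
     {z \<in> carrier G. \<forall>g \<in> carrier G. z \<otimes>\<^bsub>G\<^esub> g = g \<otimes>\<^bsub>G\<^esub> z}"

definition p_extraspecial :: "nat \<Rightarrow> ('a, 'b) monoid_scheme \<Rightarrow> bool" where
  "p_extraspecial p G \<longleftrightarrow>
     group G \<and> finite (carrier G) \<and>
     (\<exists>n::nat. Coset.order G = p ^ (2 * n + 1)) \<and>
     card (group_center G) = p \<and>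
     card (derived G (carrier G)) = p \<and>
     comm_group (G Mod group_center G) \<and>
     (\<forall>x \<in> carrier (G Mod group_center G).
        x \<noteq> \<one>\<^bsub>G Mod group_center G\<^esub> \<longrightarrow> group.ord (G Mod group_center G) x = p)"

section \<open>Complex characters\<close>

definition GL_mat :: "nat \<Rightarrow> complex mat monoid" where
  "GL_mat d = units_of (ring_mat TYPE(complex) d ())"

definition irreducible_rep ::
  "('a, 'b) monoid_scheme \<Rightarrow> nat \<Rightarrow> ('a \<Rightarrow> complex mat) \<Rightarrow> bool" where
  "irreducible_rep G d \<rho> \<longleftrightarrow>
     d > 0 \<and> \<rho> \<in> hom G (GL_mat d) \<and>
     (\<forall>W. VectorSpace.subspace class_ring W (module_vec TYPE(complex) d) \<longrightarrow>
          (\<forall>g \<in> carrier G. \<forall>w \<in> W. \<rho> g *\<^sub>v w \<in> W) \<longrightarrow>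
          W = {0\<^sub>v d} \<or> W = carrier_vec d)"

definition mat_trace :: "complex mat \<Rightarrow> complex" where
  "mat_trace A = (\<Sum>i<dim_row A. A $$ (i, i))"

text \<open>Characters are restricted to the carrier (and \<open>undefined\<close> outside it), so that
  characters agreeing on the group are equal and \<open>Irr G\<close> has no duplicates.\<close>

definition rep_character ::
  "('a, 'b) monoid_scheme \<Rightarrow> ('a \<Rightarrow> complex mat) \<Rightarrow> 'a \<Rightarrow> complex" where
  "rep_character G \<rho> = (\<lambda>g \<in> carrier G. mat_trace (\<rho> g))"

definition Irr :: "('a, 'b) monoid_scheme \<Rightarrow> ('a \<Rightarrow> complex) set" where
  "Irr G = {rep_character G \<rho> | d \<rho>. irreducible_rep G d \<rho>}"

text \<open>The trace of the identity matrix, so the dimension of any representation affording \<open>\<chi>\<close>.\<close>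

definition char_degree :: "('a, 'b) monoid_scheme \<Rightarrow> ('a \<Rightarrow> complex) \<Rightarrow> complex" where
  "char_degree G \<chi> = \<chi> \<one>\<^bsub>G\<^esub>"

definition Conj :: "('a, 'b) monoid_scheme \<Rightarrow> 'a set set" where
  "Conj G = orbits G (carrier G)
     (\<lambda>g. \<lambda>h \<in> carrier G. g \<otimes>\<^bsub>G\<^esub> h \<otimes>\<^bsub>G\<^esub> inv\<^bsub>G\<^esub> g)"

definition class_value :: "('a \<Rightarrow> complex) \<Rightarrow> 'a set \<Rightarrow> complex" where
  "class_value \<chi> C = (THE z. \<forall>x \<in> C. \<chi> x = z)"

section \<open>The ZL-amenability constant\<close>

definition AM_Z :: "('a, 'b) monoid_scheme \<Rightarrow> real" where
  "AM_Z G =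
     1 / (real (Coset.order G))\<^sup>2 *
     (\<Sum>C \<in> Conj G. \<Sum>D \<in> Conj G.
        cmod (\<Sum>\<chi> \<in> Irr G.
                (char_degree G \<chi>)\<^sup>2 * class_value \<chi> C * cnj (class_value \<chi> D)) *
        real (card C) * real (card D))"

end

theory Submission
  imports Defs "Jordan_Normal_Form.Spectral_Radius"
begin

text \<open>
  Since \<open>G/Z\<close> is abelian and \<open>Z\<close> has prime order, a representation with trivial central
  character is linear. If the central character \<open>\<omega>\<close> is nontrivial, it is faithful on \<open>Z\<close>, and as
  every noncentral \<open>x\<close> is conjugate to \<open>z x\<close> for some \<open>z \<noteq> 1\<close> in \<open>Z\<close>, the character vanishes
  off \<open>Z\<close>; its norm then forces the degree \<open>p\<^sup>n\<close>. Every \<open>\<omega>\<close> does occur: inside the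
  regular representation, a generator of \<open>Z\<close> has every \<open>p\<close>-th root of unity as an eigenvalue, and a
  representation of least degree on which it acts by the given scalar is irreducible. With the
  characters known, the kernel \<open>\<Sum>\<chi>. d\<^sub>\<chi>\<^sup>2 \<chi>(x) cnj (\<chi>(y))\<close> reduces to sums over the linear characters
  of \<open>G\<close> and of \<open>Z\<close>, and the sum over pairs of classes is a sum over pairs of elements.
\<close>

section \<open>Subspaces and matrix representations\<close>

text \<open>Write K(x, y) for the kernel. Without absolute values, its sum over all pairs is the sum
  over \<chi> of the squared degree times |sum of \<chi>|^2. Only the trivial character contributes,
  so the normalised total is 1, and absolute values add twice the negative part of K. K can be
  negative only at distinct central x and y, which make p(p - 1) pairs, and there it is p^(2n) -
  p^(4n). Dividing 2p(p - 1)(p^(4n) - p^(2n)) by |G|^2 = p^(4n + 2) gives the correction term of the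
  theorem.

  Irreducibility speaks of invariant subspaces of a coordinate space, so passing to a
  subrepresentation means choosing a basis and rewriting the action in smaller matrices. A
  representation of least degree replaces a decomposition of the regular one. \<open>Irr G\<close>
  is found by classifying its members and constructing each of them, so neither a count of classes
  nor the sum of squared degrees enters. The norm formula pairs \<rho>(g) with \<rho>(g^-1) instead
  of a conjugate, so no invariant inner product is needed.\<close>

lemma subspaceI:
  fixes W :: "'a::field vec set"
  assumes "W \<subseteq> carrier_vec n" "0\<^sub>v n \<in> W"
    and "\<And>v w. v \<in> W \<Longrightarrow> w \<in> W \<Longrightarrow> v + w \<in> W"
    and "\<And>c v. v \<in> W \<Longrightarrow> c \<cdot>\<^sub>v v \<in> W"
  shows "VectorSpace.subspace class_ring W (module_vec TYPE('a) n)"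
proof -
  interpret vec_space "TYPE('a)" n .
  show ?thesis
    unfolding VectorSpace.subspace_def submodule_def
    using assms vec_vs[of n, where 'a = 'a] by (auto simp: vectorspace_def module_vec_simps)
qed

lemma subspaceD:
  fixes W :: "'a::field vec set"
  assumes "VectorSpace.subspace class_ring W (module_vec TYPE('a) n)"
  shows "W \<subseteq> carrier_vec n" "0\<^sub>v n \<in> W"
    and "\<And>v w. v \<in> W \<Longrightarrow> w \<in> W \<Longrightarrow> v + w \<in> W"
    and "\<And>c v. v \<in> W \<Longrightarrow> c \<cdot>\<^sub>v v \<in> W"
  using assms unfolding VectorSpace.subspace_def submodule_def
  by (auto simp: module_vec_simps class_ring_simps)

text \<open>A maximal independent subset of W spans W, and its elements become the columns of B. The
  map v to B v is then a coordinate system on W, which turns an action on W into matrices of size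
  e.\<close>

lemma subspace_as_column_space:
  fixes W :: "'a::field vec set"
  assumes "VectorSpace.subspace class_ring W (module_vec TYPE('a) n)"
  obtains e B where "e \<le> n" "B \<in> carrier_mat n e"
    "\<And>v. v \<in> carrier_vec e \<Longrightarrow> B *\<^sub>v v = 0\<^sub>v n \<Longrightarrow> v = 0\<^sub>v e"
    "W = (\<lambda>v. B *\<^sub>v v) ` carrier_vec e" "e = n \<Longrightarrow> W = carrier_vec n"
proof -
  interpret vec_space "TYPE('a)" n .
  note W = subspaceD[OF assms]
  let ?P = "\<lambda>S. S \<subseteq> W \<and> lin_indpt S"
  have "\<exists>S. finite S \<and> maximal S ?P"
  proof (rule maximal_exists[where N = n and B = "{}"])
    show "finite S \<and> card S \<le> n" if "?P S" for S
      using li_le_dim[OF fin_dim, of S] that W(1) unfolding dim_is_n cV by blast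
    show "?P {}" unfolding lin_dep_def by blast
  qed
  then obtain S where fin: "finite S" and SW: "S \<subseteq> W" and li: "lin_indpt S"
    and max: "\<And>T. S \<subseteq> T \<Longrightarrow> ?P T \<Longrightarrow> T = S"
    unfolding maximal_def by metis
  have Sc: "S \<subseteq> carrier_vec n" using SW W(1) by auto
  have span: "span S = W"
  proof
    show "span S \<subseteq> W" using span_is_subset[OF SW] assms by (auto simp: VectorSpace.subspace_def)
    show "W \<subseteq> span S"
    proof
      fix w assume w: "w \<in> W"
      show "w \<in> span S"
      proof (rule ccontr)
        assume n: "w \<notin> span S"
        then have "w \<notin> S" using in_own_span[OF Sc] by auto
        then have "lin_indpt (S \<union> {w})"
          using lin_dep_iff_in_span[of S w] Sc li w W(1) n by auto
        then have "S \<union> {w} = S" using max[of "S \<union> {w}"] SW w by auto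
        then show False using \<open>w \<notin> S\<close> by auto
      qed
    qed
  qed
  obtain bs where bs: "set bs = S" "distinct bs" using finite_distinct_list[OF fin] by auto
  define e where "e = length bs"
  have card: "card S = e" using bs distinct_card e_def by metis
  have bsc: "bs ! i \<in> carrier_vec n" if "i < length bs" for i using bs Sc that by auto
  show thesis
  proof (rule that[of e "mat_of_cols n bs"])
    show "e \<le> n" using li_le_dim[of S] Sc li card dim_is_n by auto
    show "mat_of_cols n bs \<in> carrier_mat n e" by (simp add: e_def)
    show "v = 0\<^sub>v e" if v: "v \<in> carrier_vec e" and z: "mat_of_cols n bs *\<^sub>v v = 0\<^sub>v n" for v
    proof -
      \<comment> \<open>\<open>f\<close> collects the coefficient of each basis vector. As the list
        has no repetitions, the coefficient of \<open>bs ! j\<close> is just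
        \<open>v $ j\<close>.\<close>
      define f where "f = (\<lambda>l. \<Sum>i = 0..<length bs. if l = bs ! i then v $ i else 0)"
      have "lincomb f S = 0\<^sub>v n"
        using mat_of_cols_mult_as_finsum[of v bs] v z bsc bs by (simp add: e_def f_def)
      then have f0: "f s = 0" if "s \<in> S" for s
        using li fin that unfolding lin_dep_def by auto
      show ?thesis
      proof (rule eq_vecI)
        show "v $ j = 0\<^sub>v e $ j" if "j < dim_vec (0\<^sub>v e)" for j
        proof -
          have j: "j < length bs" using that by (simp add: e_def)
          have "f (bs ! j) = (\<Sum>i = 0..<length bs. if i = j then v $ i else 0)"
            unfolding f_def using j bs(2) by (intro sum.cong) (auto simp: nth_eq_iff_index_eq)
          also have "\<dots> = v $ j" using j by simp
          finally show ?thesis using f0[of "bs ! j"] nth_mem[OF j] bs(1) j by (simp add: e_def)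
        qed
      qed (use v in simp)
    qed
    show "W = (\<lambda>v. mat_of_cols n bs *\<^sub>v v) ` carrier_vec e"
    proof -
      have dims: "\<forall>w\<in>set bs. dim_vec w = n" using bs Sc by auto
      have "W = {mat_of_cols n bs *\<^sub>v vec e c | c. True}"
        using span span_list_as_span[of bs] bs Sc lincomb_list_as_mat_mult[OF dims]
        by (simp add: span_list_def e_def)
      also have "\<dots> = (\<lambda>v. mat_of_cols n bs *\<^sub>v v) ` carrier_vec e"
      proof -
        have "v = vec e (($) v)" if "v \<in> carrier_vec e" for v :: "'a vec" using that by auto
        then show ?thesis by (auto simp: image_iff) (metis vec_carrier)+
      qed
      finally show ?thesis .
    qed
    show "W = carrier_vec n" if "e = n"
      using dim_li_is_basis[of S] fin Sc li card that dim_is_n span by (auto simp: basis_def)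
  qed
qed

text \<open>A homomorphism into \<open>GL_mat d\<close> spelled out on matrices. Invertibility of
  \<rho>(g) comes from the two equations at g and its inverse, so no units of the matrix ring have
  to be handled.\<close>

definition matrix_rep ::
  "('a, 'b) monoid_scheme \<Rightarrow> nat \<Rightarrow> ('a \<Rightarrow> complex mat) \<Rightarrow> bool" where
  "matrix_rep G d \<rho> \<longleftrightarrow> (\<forall>g \<in> carrier G. \<rho> g \<in> carrier_mat d d) \<and> \<rho> \<one>\<^bsub>G\<^esub> = 1\<^sub>m d \<and>
     (\<forall>g \<in> carrier G. \<forall>h \<in> carrier G. \<rho> (g \<otimes>\<^bsub>G\<^esub> h) = \<rho> g * \<rho> h)"

lemma matrix_repD:
  assumes "matrix_rep G d \<rho>"
  shows "g \<in> carrier G \<Longrightarrow> \<rho> g \<in> carrier_mat d d"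
    and "\<rho> \<one>\<^bsub>G\<^esub> = 1\<^sub>m d"
    and "g \<in> carrier G \<Longrightarrow> h \<in> carrier G \<Longrightarrow> \<rho> (g \<otimes>\<^bsub>G\<^esub> h) = \<rho> g * \<rho> h"
  using assms unfolding matrix_rep_def by auto

lemma (in group) hom_GL_mat_iff: "\<rho> \<in> hom G (GL_mat d) \<longleftrightarrow> matrix_rep G d \<rho>"
proof
  let ?R = "ring_mat TYPE(complex) d ()"
  have R: "monoid ?R" using ring_mat[of d "()"] ring.is_monoid by auto
  have GL: "group (GL_mat d)" unfolding GL_mat_def by (rule monoid.units_group[OF R])
  have one: "\<one>\<^bsub>GL_mat d\<^esub> = 1\<^sub>m d" by (simp add: GL_mat_def units_of_def ring_mat_simps)
  have mult: "A \<otimes>\<^bsub>GL_mat d\<^esub> B = A * B" for A B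
    by (simp add: GL_mat_def units_of_def ring_mat_simps)
  have car: "carrier (GL_mat d) = Units ?R" by (simp add: GL_mat_def units_of_def)
  show "matrix_rep G d \<rho>" if h: "\<rho> \<in> hom G (GL_mat d)"
  proof -
    have "\<rho> g \<in> carrier_mat d d" if "g \<in> carrier G" for g
    proof -
      have "\<rho> g \<in> Units ?R" using h that by (auto simp: hom_def car)
      then show ?thesis by (auto simp: Units_def ring_mat_simps)
    qed
    moreover have "\<rho> \<one> = 1\<^sub>m d" using hom_one[OF h is_group GL] one by simp
    ultimately show ?thesis using h by (auto simp: matrix_rep_def hom_def mult)
  qed
  show "\<rho> \<in> hom G (GL_mat d)" if r: "matrix_rep G d \<rho>"
  proof -
    note D = matrix_repD[OF r]
    have "\<rho> g \<in> Units ?R" if g: "g \<in> carrier G" for g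
    proof -
      have "\<rho> (inv g) * \<rho> g = 1\<^sub>m d" "\<rho> g * \<rho> (inv g) = 1\<^sub>m d"
        using D(2) D(3)[of "inv g" g] D(3)[of g "inv g"] g by auto
      then show ?thesis using D(1) g by (auto simp: Units_def ring_mat_simps)
    qed
    then show ?thesis using D by (auto simp: hom_def car mult)
  qed
qed

lemma (in group) irreducible_rep_iff:
  "irreducible_rep G d \<rho> \<longleftrightarrow> d > 0 \<and> matrix_rep G d \<rho> \<and>
     (\<forall>W. VectorSpace.subspace class_ring W (module_vec TYPE(complex) d) \<longrightarrow>
          (\<forall>g \<in> carrier G. \<forall>w \<in> W. \<rho> g *\<^sub>v w \<in> W) \<longrightarrow>
          W = {0\<^sub>v d} \<or> W = carrier_vec d)"
  unfolding irreducible_rep_def hom_GL_mat_iff ..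

lemma mult_mat_unit_vec:
  fixes A :: "'a::comm_ring_1 mat"
  assumes "A \<in> carrier_mat n m" "i < m"
  shows "A *\<^sub>v unit_vec m i = col A i"
  using assms by (intro eq_vecI) (auto simp: scalar_prod_right_unit)

lemma scalar_mat_mult_vec:
  fixes v :: "'a::comm_ring_1 vec"
  assumes "v \<in> carrier_vec n"
  shows "(c \<cdot>\<^sub>m 1\<^sub>m n) *\<^sub>v v = c \<cdot>\<^sub>v v"
  using assms by (intro eq_vecI) auto

lemma mat_eqI_mult_vec:
  fixes A B :: "'a::comm_ring_1 mat"
  assumes "A \<in> carrier_mat n m" "B \<in> carrier_mat n m"
    and "\<And>v. v \<in> carrier_vec m \<Longrightarrow> A *\<^sub>v v = B *\<^sub>v v"
  shows "A = B"
proof (rule mat_col_eqI)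
  show "col A i = col B i" if "i < dim_col B" for i
    using assms(3)[of "unit_vec m i"] assms(1,2) that
    by (simp add: mult_mat_unit_vec[of _ n m])
qed (use assms in auto)

text \<open>Identities between restricted matrices are proved after multiplying by B on the left,
  where they become identities of the original representation.\<close>

lemma injective_mat_cancel:
  fixes B C D :: "'a::comm_ring_1 mat"
  assumes B: "B \<in> carrier_mat n e"
    and inj: "\<And>v. v \<in> carrier_vec e \<Longrightarrow> B *\<^sub>v v = 0\<^sub>v n \<Longrightarrow> v = 0\<^sub>v e"
    and C: "C \<in> carrier_mat e k" and D: "D \<in> carrier_mat e k" and eq: "B * C = B * D"
  shows "C = D"
proof (rule mat_eqI_mult_vec[OF C D])
  fix v :: "'a vec" assume v: "v \<in> carrier_vec k"
  have c: "C *\<^sub>v v \<in> carrier_vec e" "D *\<^sub>v v \<in> carrier_vec e" using C D v by auto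
  have "B *\<^sub>v (C *\<^sub>v v - D *\<^sub>v v) = B *\<^sub>v (C *\<^sub>v v) - B *\<^sub>v (D *\<^sub>v v)"
    by (rule mult_minus_distrib_mat_vec[OF B c])
  also have "\<dots> = (B * C) *\<^sub>v v - (B * D) *\<^sub>v v" using B C D v by simp
  also have "\<dots> = 0\<^sub>v n" unfolding eq using B D v by auto
  finally have z: "C *\<^sub>v v - D *\<^sub>v v = 0\<^sub>v e" using inj c by auto
  show "C *\<^sub>v v = D *\<^sub>v v"
  proof (rule eq_vecI)
    show "(C *\<^sub>v v) $ i = (D *\<^sub>v v) $ i" if "i < dim_vec (D *\<^sub>v v)" for i
    proof -
      have "(C *\<^sub>v v - D *\<^sub>v v) $ i = 0" using z that D by simp
      then show ?thesis using that by simp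
    qed
  qed (use C D in simp)
qed

text \<open>With the columns of B a basis of W, invariance means \<rho>(g) B = B \<sigma>(g), and
  injectivity of B makes \<sigma> multiplicative. The scalar of z is carried along because the
  argument by least degree needs the smaller representation to satisfy the same condition.\<close>

lemma (in group) restrict_rep:
  assumes r: "matrix_rep G n \<rho>"
    and W: "VectorSpace.subspace class_ring W (module_vec TYPE(complex) n)"
    and invar: "\<And>g w. g \<in> carrier G \<Longrightarrow> w \<in> W \<Longrightarrow> \<rho> g *\<^sub>v w \<in> W"
    and nz: "W \<noteq> {0\<^sub>v n}" and z: "z \<in> carrier G"
    and scal: "\<And>w. w \<in> W \<Longrightarrow> \<rho> z *\<^sub>v w = \<zeta> \<cdot>\<^sub>v w"
  obtains e \<sigma> where "0 < e" "e < n \<or> W = carrier_vec n" "matrix_rep G e \<sigma>"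
    "\<sigma> z = \<zeta> \<cdot>\<^sub>m 1\<^sub>m e"
proof -
  note D = matrix_repD[OF r]
  obtain e B where e: "e \<le> n" and B: "B \<in> carrier_mat n e"
    and inj: "\<And>v. v \<in> carrier_vec e \<Longrightarrow> B *\<^sub>v v = 0\<^sub>v n \<Longrightarrow> v = 0\<^sub>v e"
    and WB: "W = (\<lambda>v. B *\<^sub>v v) ` carrier_vec e" and en: "e = n \<Longrightarrow> W = carrier_vec n"
    using subspace_as_column_space[OF W] by metis
  have e0: "0 < e"
  proof (rule ccontr)
    assume "\<not> 0 < e"
    then have "e = 0" by simp
    have "B *\<^sub>v v = 0\<^sub>v n" if "v \<in> carrier_vec e" for v
      using that B \<open>e = 0\<close> by (intro eq_vecI) (auto simp: scalar_prod_def)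
    then have "W \<subseteq> {0\<^sub>v n}" using WB by auto
    moreover have "0\<^sub>v n \<in> W" using subspaceD(2)[OF W] .
    ultimately show False using nz by auto
  qed
  have "\<exists>S. S \<in> carrier_mat e e \<and> \<rho> g * B = B * S" if g: "g \<in> carrier G" for g
  proof -
    have "\<exists>v. v \<in> carrier_vec e \<and> \<rho> g *\<^sub>v col B j = B *\<^sub>v v" if "j < e" for j
    proof -
      have "col B j = B *\<^sub>v unit_vec e j" using mult_mat_unit_vec[OF B that] by simp
      then have "col B j \<in> W" using WB that by auto
      then show ?thesis using invar[OF g] WB by auto
    qed
    then obtain v where v: "\<And>j. j < e \<Longrightarrow> v j \<in> carrier_vec e \<and> \<rho> g *\<^sub>v col B j = B *\<^sub>v v j"
      by metis
    \<comment> \<open>Column j of \<open>S\<close> holds the coordinates of \<rho>(g) applied to the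
      j-th basis vector.\<close>
    define S where "S = mat_of_cols e (map v [0..<e])"
    have Sc: "S \<in> carrier_mat e e" using mat_of_cols_carrier(1)[of e "map v [0..<e]"] by (simp add: S_def)
    have "\<rho> g * B = B * S"
    proof (rule mat_col_eqI)
      show "col (\<rho> g * B) j = col (B * S) j" if "j < dim_col (B * S)" for j
      proof -
        have j: "j < e" using that Sc by simp
        have "col (\<rho> g * B) j = \<rho> g *\<^sub>v col B j" by (rule col_mult2[OF D(1)[OF g] B j])
        also have "\<dots> = B *\<^sub>v col S j" using v[OF j] j by (simp add: S_def)
        also have "\<dots> = col (B * S) j" by (rule col_mult2[OF B Sc j, symmetric])
        finally show ?thesis .
      qed
    qed (use D(1)[OF g] B Sc in auto)
    then show ?thesis using Sc by auto
  qed
  then obtain \<sigma> where \<sigma>: "\<And>g. g \<in> carrier G \<Longrightarrow> \<sigma> g \<in> carrier_mat e e"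
    and inter: "\<And>g. g \<in> carrier G \<Longrightarrow> \<rho> g * B = B * \<sigma> g" by metis
  have one: "\<sigma> \<one> = 1\<^sub>m e"
    by (rule injective_mat_cancel[OF B inj]) (use \<sigma> inter[of \<one>] D(2) B in auto)
  have mult: "\<sigma> (g \<otimes> h) = \<sigma> g * \<sigma> h" if g: "g \<in> carrier G" and h: "h \<in> carrier G" for g h
  proof (rule injective_mat_cancel[OF B inj])
    have "B * \<sigma> (g \<otimes> h) = \<rho> (g \<otimes> h) * B" using inter g h by simp
    also have "\<dots> = \<rho> g * (\<rho> h * B)" using D g h B by (simp add: assoc_mult_mat[of _ n n _ n _ e])
    also have "\<dots> = (\<rho> g * B) * \<sigma> h"
      unfolding inter[OF h] by (rule assoc_mult_mat[symmetric]) (use D(1) g B \<sigma> h in auto)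
    also have "\<dots> = B * (\<sigma> g * \<sigma> h)"
      unfolding inter[OF g] by (rule assoc_mult_mat) (use g B \<sigma> h in auto)
    finally show "B * \<sigma> (g \<otimes> h) = B * (\<sigma> g * \<sigma> h)" .
  qed (use \<sigma> g h mult_carrier_mat[of "\<sigma> g" e e "\<sigma> h" e] in auto)
  have "\<sigma> z = \<zeta> \<cdot>\<^sub>m 1\<^sub>m e"
  proof (rule injective_mat_cancel[OF B inj \<sigma>[OF z]])
    show "B * \<sigma> z = B * (\<zeta> \<cdot>\<^sub>m 1\<^sub>m e)"
    proof (rule mat_eqI_mult_vec[of _ n e])
      fix v :: "complex vec" assume v: "v \<in> carrier_vec e"
      have "(B * \<sigma> z) *\<^sub>v v = (\<rho> z * B) *\<^sub>v v" using inter z by simp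
      also have "\<dots> = \<zeta> \<cdot>\<^sub>v (B *\<^sub>v v)" using scal WB v D(1)[OF z] B by simp
      also have "\<dots> = (B * (\<zeta> \<cdot>\<^sub>m 1\<^sub>m e)) *\<^sub>v v"
        using B v by (simp add: assoc_mult_mat_vec[OF B _ v] scalar_mat_mult_vec mult_mat_vec)
      finally show "(B * \<sigma> z) *\<^sub>v v = (B * (\<zeta> \<cdot>\<^sub>m 1\<^sub>m e)) *\<^sub>v v" .
    qed (use B \<sigma> z in auto)
  qed auto
  moreover have "matrix_rep G e \<sigma>" using \<sigma> one mult by (auto simp: matrix_rep_def)
  ultimately show ?thesis using that e e0 en le_neq_implies_less by metis
qed

section \<open>Schur's lemma and existence of irreducible representations\<close>

lemma eigenspace_subspace:
  fixes A :: "'a::field mat"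
  assumes A: "A \<in> carrier_mat n n"
  shows "VectorSpace.subspace class_ring {v \<in> carrier_vec n. A *\<^sub>v v = c \<cdot>\<^sub>v v}
           (module_vec TYPE('a) n)"
  using A by (intro subspaceI)
    (auto simp: mult_add_distrib_mat_vec[OF A] smult_add_distrib_vec[of _ n]
      mult_mat_vec[OF A] smult_smult_assoc mult.commute)

lemma eigenspace_invariant:
  fixes A B :: "'a::field mat"
  assumes A: "A \<in> carrier_mat n n" and B: "B \<in> carrier_mat n n" and comm: "B * A = A * B"
    and w: "w \<in> {v \<in> carrier_vec n. A *\<^sub>v v = c \<cdot>\<^sub>v v}"
  shows "B *\<^sub>v w \<in> {v \<in> carrier_vec n. A *\<^sub>v v = c \<cdot>\<^sub>v v}"
proof -
  have wc: "w \<in> carrier_vec n" "A *\<^sub>v w = c \<cdot>\<^sub>v w" using w by auto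
  have "A *\<^sub>v (B *\<^sub>v w) = B *\<^sub>v (A *\<^sub>v w)"
    using comm A B wc(1) by (metis assoc_mult_mat_vec)
  also have "\<dots> = c \<cdot>\<^sub>v (B *\<^sub>v w)" using wc B by (simp add: mult_mat_vec)
  finally show ?thesis using B wc by auto
qed

text \<open>Over the complex numbers A has an eigenvalue. Its eigenspace is nonzero and invariant,
  since A commutes with the representation, hence it is the whole space.\<close>

lemma (in group) schur_scalar:
  assumes irr: "irreducible_rep G d \<rho>" and A: "A \<in> carrier_mat d d"
    and comm: "\<And>g. g \<in> carrier G \<Longrightarrow> \<rho> g * A = A * \<rho> g"
  obtains c where "A = c \<cdot>\<^sub>m 1\<^sub>m d"
proof -
  have d: "d > 0" and r: "matrix_rep G d \<rho>"
    and simple: "\<And>W. VectorSpace.subspace class_ring W (module_vec TYPE(complex) d) \<Longrightarrow>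
          (\<forall>g \<in> carrier G. \<forall>w \<in> W. \<rho> g *\<^sub>v w \<in> W) \<Longrightarrow> W = {0\<^sub>v d} \<or> W = carrier_vec d"
    using irr unfolding irreducible_rep_iff by auto
  note D = matrix_repD[OF r]
  obtain c where "c \<in> spectrum A" using spectrum_non_empty[OF A] d by auto
  then obtain v where v: "v \<in> carrier_vec d" "v \<noteq> 0\<^sub>v d" "A *\<^sub>v v = c \<cdot>\<^sub>v v"
    using A by (auto simp: spectrum_def eigenvalue_def eigenvector_def)
  define W where "W = {v \<in> carrier_vec d. A *\<^sub>v v = c \<cdot>\<^sub>v v}"
  have "VectorSpace.subspace class_ring W (module_vec TYPE(complex) d)"
    unfolding W_def by (rule eigenspace_subspace[OF A])
  moreover have "\<rho> g *\<^sub>v w \<in> W" if "g \<in> carrier G" "w \<in> W" for g w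
    using eigenspace_invariant[OF A D(1) comm] that unfolding W_def by blast
  ultimately have "W = {0\<^sub>v d} \<or> W = carrier_vec d" using simple by blast
  moreover have "v \<in> W" using v by (auto simp: W_def)
  ultimately have W: "W = carrier_vec d" using v by auto
  have "A = c \<cdot>\<^sub>m 1\<^sub>m d"
  proof (rule mat_eqI_mult_vec[OF A])
    show "A *\<^sub>v v = (c \<cdot>\<^sub>m 1\<^sub>m d) *\<^sub>v v" if "v \<in> carrier_vec d" for v
      using that W by (auto simp: W_def scalar_mat_mult_vec)
  qed auto
  then show ?thesis by (rule that)
qed

section \<open>Regular representation and irreducible representations with a prescribed
  scalar\<close>

text \<open>The witness is \<open>z\<^sup>-\<^sup>k \<mapsto> \<zeta>\<^sup>k\<close>, extended by zero outside the subgroup generated by \<open>z\<close>.\<close>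

lemma (in group) exists_translation_eigenfunction:
  fixes \<zeta> :: complex
  assumes z: "z \<in> carrier G" and \<zeta>: "\<zeta> ^ ord z = 1" and pos: "ord z > 0"
  obtains f where "f \<one> = 1" "\<And>g. g \<in> carrier G \<Longrightarrow> f (inv z \<otimes> g) = \<zeta> * f g"
proof -
  define f where "f = (\<lambda>g. if \<exists>k::nat. g = inv z [^] k then \<zeta> ^ (SOME k. g = inv z [^] k) else 0)"
  have iz: "inv z \<in> carrier G" using z by simp
  have f_pow: "f (inv z [^] k) = \<zeta> ^ k" for k :: nat
  proof -
    \<comment> \<open>The exponent chosen by \<open>SOME\<close> may differ from \<open>k\<close>,
      but only by a multiple of \<open>ord z\<close>, which \<zeta> does not see.\<close>
    define j where "j = (SOME j. inv z [^] k = inv z [^] (j::nat))"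
    have eq: "inv z [^] k = inv z [^] j" unfolding j_def by (rule someI[of _ k]) simp
    have *: "\<zeta> ^ j = \<zeta> ^ k" if "j \<le> k" "inv z [^] k = inv z [^] j" for j k :: nat
    proof -
      obtain m where k: "k = j + m" using \<open>j \<le> k\<close> le_Suc_ex by blast
      have "inv z [^] j \<otimes> inv z [^] m = inv z [^] j"
        using that(2) iz by (simp add: k nat_pow_mult)
      then have "inv z [^] m = \<one>" using iz by (metis l_cancel_one nat_pow_closed)
      then have "ord z dvd m" using pow_eq_id[OF iz] z by simp
      then show ?thesis using \<zeta> by (auto simp: k power_add power_mult elim!: dvdE)
    qed
    have "\<zeta> ^ j = \<zeta> ^ k" using *[of j k] *[of k j] eq nat_le_linear by metis
    then show ?thesis by (auto simp: f_def j_def[symmetric])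
  qed
  have "f \<one> = 1" using f_pow[of 0] by simp
  moreover have "f (inv z \<otimes> g) = \<zeta> * f g" if g: "g \<in> carrier G" for g
  proof (cases "\<exists>k::nat. g = inv z [^] k")
    case True
    then obtain k :: nat where k: "g = inv z [^] k" by auto
    have "inv z \<otimes> g = inv z [^] Suc k" using k iz nat_pow_Suc2 by metis
    then show ?thesis using f_pow[of k] f_pow[of "Suc k"] k by simp
  next
    case False
    have "\<not> (\<exists>k::nat. inv z \<otimes> g = inv z [^] k)"
    proof
      assume "\<exists>k::nat. inv z \<otimes> g = inv z [^] k"
      then obtain k :: nat where k: "inv z \<otimes> g = inv z [^] k" by auto
      \<comment> \<open>Since \<open>z\<close> is itself a natural power of its inverse, translation
        by \<open>inv z\<close> cannot carry an element from outside the generated subgroup into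
        it.\<close>
      have z_pow: "z = inv z [^] (ord z - 1)"
      proof -
        have "inv z \<otimes> inv z [^] (ord z - 1) = inv z [^] Suc (ord z - 1)"
          using iz nat_pow_Suc2 by metis
        also have "\<dots> = \<one>" using pos pow_ord_eq_1[OF iz] z by simp
        finally have "z \<otimes> (inv z \<otimes> inv z [^] (ord z - 1)) = z" using z by simp
        then show ?thesis using z iz by (simp add: m_assoc[symmetric])
      qed
      have "g = z \<otimes> inv z [^] k" unfolding k[symmetric] using z g by (simp add: m_assoc[symmetric])
      then have "g = inv z [^] (ord z - 1) \<otimes> inv z [^] k" using z_pow by metis
      then have "g = inv z [^] (ord z - 1 + k)" using iz by (simp add: nat_pow_mult)
      then show False using False by blast
    qed
    then show ?thesis using False by (simp add: f_def)
  qed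
  ultimately show ?thesis by (rule that)
qed

text \<open>Vectors are functions on the group, read through the enumeration \<open>e\<close>, and g
  acts by left translation. Stating the action on functions keeps the indices out of later
  arguments.\<close>

lemma (in group) exists_regular_rep:
  assumes fin: "finite (carrier G)"
  obtains e \<rho> where "bij_betw e {0..<Coset.order G} (carrier G)" "matrix_rep G (Coset.order G) \<rho>"
    "\<And>g f. g \<in> carrier G \<Longrightarrow>
       \<rho> g *\<^sub>v vec (Coset.order G) (\<lambda>i. f (e i)) = vec (Coset.order G) (\<lambda>i. f (inv g \<otimes> e i))"
proof -
  let ?N = "Coset.order G"
  obtain e where e: "bij_betw e {0..<?N} (carrier G)"
    using ex_bij_betw_nat_finite[OF fin] by (auto simp: Coset.order_def)
  have ec: "e i \<in> carrier G" if "i < ?N" for i using e that by (auto simp: bij_betw_def)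
  define \<rho> where "\<rho> = (\<lambda>g. mat ?N ?N (\<lambda>(i, j). if e i = g \<otimes> e j then 1 else (0::complex)))"
  have act: "\<rho> g *\<^sub>v vec ?N (\<lambda>i. f (e i)) = vec ?N (\<lambda>i. f (inv g \<otimes> e i))"
    if g: "g \<in> carrier G" for g and f :: "'a \<Rightarrow> complex"
  proof (rule eq_vecI)
    fix i assume "i < dim_vec (vec ?N (\<lambda>i. f (inv g \<otimes> e i)))"
    then have i: "i < ?N" by simp
    have "(\<rho> g *\<^sub>v vec ?N (\<lambda>i. f (e i))) $ i
        = (\<Sum>j = 0..<?N. (if e i = g \<otimes> e j then 1 else 0) * f (e j))"
      using i by (simp add: \<rho>_def scalar_prod_def)
    also have "\<dots> = (\<Sum>h \<in> carrier G. (if e i = g \<otimes> h then 1 else 0) * f h)"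
      by (rule sum.reindex_bij_betw[OF e])
    also have "\<dots> = (\<Sum>h \<in> carrier G. if h = inv g \<otimes> e i then f h else 0)"
    proof (rule sum.cong[OF refl])
      fix h assume h: "h \<in> carrier G"
      have "e i = g \<otimes> h \<longleftrightarrow> h = inv g \<otimes> e i"
        using g h ec[OF i] by (metis inv_solve_left)
      then show "(if e i = g \<otimes> h then 1 else 0) * f h = (if h = inv g \<otimes> e i then f h else 0)"
        by auto
    qed
    also have "\<dots> = f (inv g \<otimes> e i)" using fin g ec[OF i] by simp
    finally show "(\<rho> g *\<^sub>v vec ?N (\<lambda>i. f (e i))) $ i = vec ?N (\<lambda>i. f (inv g \<otimes> e i)) $ i"
      using i by simp
  qed (simp add: \<rho>_def)
  \<comment> \<open>Every vector comes from a function on the group, so matrix identities may be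
    tested with \<open>act\<close> alone.\<close>
  have fn: "\<exists>f. v = vec ?N (\<lambda>i. f (e i))" if "v \<in> carrier_vec ?N" for v :: "complex vec"
  proof (intro exI eq_vecI)
    show "v $ i = vec ?N (\<lambda>i. v $ (inv_into {0..<?N} e (e i))) $ i"
      if "i < dim_vec (vec ?N (\<lambda>i. v $ (inv_into {0..<?N} e (e i))))" for i
      using that e by (simp add: bij_betw_def inv_into_f_f)
  qed (use that in simp)
  have \<rho>c: "\<rho> g \<in> carrier_mat ?N ?N" for g by (simp add: \<rho>_def)
  have "matrix_rep G ?N \<rho>"
    unfolding matrix_rep_def
  proof (intro conjI ballI \<rho>c)
    show "\<rho> \<one> = 1\<^sub>m ?N"
    proof (rule mat_eqI_mult_vec[OF \<rho>c])
      fix v :: "complex vec" assume v: "v \<in> carrier_vec ?N"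
      then obtain f where f: "v = vec ?N (\<lambda>i. f (e i))" using fn by blast
      have "\<rho> \<one> *\<^sub>v v = vec ?N (\<lambda>i. f (e i))"
        unfolding f act[OF one_closed] using ec by (intro eq_vecI) auto
      then show "\<rho> \<one> *\<^sub>v v = 1\<^sub>m ?N *\<^sub>v v" using f v by simp
    qed simp
    fix g h assume g: "g \<in> carrier G" and h: "h \<in> carrier G"
    show "\<rho> (g \<otimes> h) = \<rho> g * \<rho> h"
    proof (rule mat_eqI_mult_vec[OF \<rho>c])
      fix v :: "complex vec" assume v: "v \<in> carrier_vec ?N"
      then obtain f where f: "v = vec ?N (\<lambda>i. f (e i))" using fn by blast
      have "\<rho> (g \<otimes> h) *\<^sub>v v = vec ?N (\<lambda>i. f (inv h \<otimes> (inv g \<otimes> e i)))"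
        unfolding f act[OF m_closed[OF g h]] using ec g h
        by (intro eq_vecI) (auto simp: inv_mult_group m_assoc)
      also have "\<dots> = \<rho> g *\<^sub>v (\<rho> h *\<^sub>v v)"
        unfolding f act[OF h] using act[OF g, of "\<lambda>x. f (inv h \<otimes> x)"] by simp
      also have "\<dots> = (\<rho> g * \<rho> h) *\<^sub>v v" using v \<rho>c by (metis assoc_mult_mat_vec)
      finally show "\<rho> (g \<otimes> h) *\<^sub>v v = (\<rho> g * \<rho> h) *\<^sub>v v" .
    qed (use mult_carrier_mat[OF \<rho>c \<rho>c] in auto)
  qed
  with e act show ?thesis by (intro that)
qed

text \<open>Centrality of z makes the \<zeta>-eigenspace in the regular representation invariant,
  and the translation eigenfunction makes it nonzero. At least degree, a proper nonzero invariant
  subspace would yield a smaller representation with the same scalar.\<close>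

lemma (in group) exists_irreducible_rep_scalar:
  fixes \<zeta> :: complex
  assumes fin: "finite (carrier G)" and z: "z \<in> carrier G"
    and central: "\<And>g. g \<in> carrier G \<Longrightarrow> z \<otimes> g = g \<otimes> z"
    and \<zeta>: "\<zeta> ^ ord z = 1"
  obtains d \<rho> where "irreducible_rep G d \<rho>" "\<rho> z = \<zeta> \<cdot>\<^sub>m 1\<^sub>m d"
proof -
  define P where "P = (\<lambda>d. d > 0 \<and> (\<exists>\<rho>. matrix_rep G d \<rho> \<and> \<rho> z = \<zeta> \<cdot>\<^sub>m 1\<^sub>m d))"
  have "\<exists>d. P d"
  proof -
    obtain e \<rho> where e: "bij_betw e {0..<Coset.order G} (carrier G)"
      and r: "matrix_rep G (Coset.order G) \<rho>"
      and act: "\<And>g f. g \<in> carrier G \<Longrightarrow> \<rho> g *\<^sub>v vec (Coset.order G) (\<lambda>i. f (e i))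
                  = vec (Coset.order G) (\<lambda>i. f (inv g \<otimes> e i))"
      by (rule exists_regular_rep[OF fin], blast)
    let ?N = "Coset.order G"
    note D = matrix_repD[OF r]
    have ec: "e i \<in> carrier G" if "i < ?N" for i using e that by (auto simp: bij_betw_def)
    obtain f where f1: "f \<one> = 1" and f: "\<And>g. g \<in> carrier G \<Longrightarrow> f (inv z \<otimes> g) = \<zeta> * f g"
      by (rule exists_translation_eigenfunction[OF z \<zeta>], use ord_ge_1[OF fin z] in simp, blast)
    define W where "W = {v \<in> carrier_vec ?N. \<rho> z *\<^sub>v v = \<zeta> \<cdot>\<^sub>v v}"
    have zc: "\<rho> z \<in> carrier_mat ?N ?N" using D(1) z .
    have W: "VectorSpace.subspace class_ring W (module_vec TYPE(complex) ?N)"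
      unfolding W_def by (rule eigenspace_subspace[OF zc])
    have invar: "\<rho> g *\<^sub>v w \<in> W" if g: "g \<in> carrier G" and w: "w \<in> W" for g w
    proof -
      have "\<rho> g * \<rho> z = \<rho> z * \<rho> g" using D(3) g z central by metis
      then show ?thesis using eigenspace_invariant[OF zc D(1)[OF g]] w unfolding W_def by blast
    qed
    have scal: "\<rho> z *\<^sub>v w = \<zeta> \<cdot>\<^sub>v w" if "w \<in> W" for w using that by (simp add: W_def)
    have "vec ?N (\<lambda>i. f (e i)) \<in> W"
    proof -
      have "\<rho> z *\<^sub>v vec ?N (\<lambda>i. f (e i)) = \<zeta> \<cdot>\<^sub>v vec ?N (\<lambda>i. f (e i))"
        unfolding act[OF z] using f ec by (intro eq_vecI) auto
      then show ?thesis by (auto simp: W_def)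
    qed
    moreover have "vec ?N (\<lambda>i. f (e i)) \<noteq> 0\<^sub>v ?N"
    proof -
      obtain i where "i < ?N" "e i = \<one>"
        using e one_closed unfolding bij_betw_def by (metis atLeastLessThan_iff imageE)
      then have "vec ?N (\<lambda>i. f (e i)) $ i \<noteq> 0\<^sub>v ?N $ i" using f1 by simp
      then show ?thesis by metis
    qed
    ultimately have ne: "W \<noteq> {0\<^sub>v ?N}" by auto
    obtain k \<sigma> where "0 < k" "matrix_rep G k \<sigma>" "\<sigma> z = \<zeta> \<cdot>\<^sub>m 1\<^sub>m k"
      by (rule restrict_rep[OF r W invar ne z scal], blast)
    then show ?thesis unfolding P_def by blast
  qed
  define d where "d = (LEAST d. P d)"
  have "P d" unfolding d_def by (rule LeastI_ex) fact
  obtain \<rho> where d: "d > 0" and r: "matrix_rep G d \<rho>" and \<rho>z: "\<rho> z = \<zeta> \<cdot>\<^sub>m 1\<^sub>m d"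
    using \<open>P d\<close> unfolding P_def by blast
  have "irreducible_rep G d \<rho>"
    unfolding irreducible_rep_iff
  proof (intro conjI allI impI d r)
    fix W assume W: "VectorSpace.subspace class_ring W (module_vec TYPE(complex) d)"
      and "\<forall>g \<in> carrier G. \<forall>w \<in> W. \<rho> g *\<^sub>v w \<in> W"
    then have invar: "\<And>g w. g \<in> carrier G \<Longrightarrow> w \<in> W \<Longrightarrow> \<rho> g *\<^sub>v w \<in> W" by blast
    show "W = {0\<^sub>v d} \<or> W = carrier_vec d"
    proof (rule ccontr)
      assume n: "\<not> (W = {0\<^sub>v d} \<or> W = carrier_vec d)"
      then have ne: "W \<noteq> {0\<^sub>v d}" by blast
      have scal: "\<rho> z *\<^sub>v w = \<zeta> \<cdot>\<^sub>v w" if "w \<in> W" for w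
        using that subspaceD(1)[OF W] by (auto simp: \<rho>z scalar_mat_mult_vec)
      obtain k \<sigma> where k: "0 < k" "k < d \<or> W = carrier_vec d"
        and \<sigma>: "matrix_rep G k \<sigma>" "\<sigma> z = \<zeta> \<cdot>\<^sub>m 1\<^sub>m k"
        by (rule restrict_rep[OF r W invar ne z scal], blast)
      have "P k" using k(1) \<sigma> unfolding P_def by blast
      moreover have "k < d" using k(2) n by blast
      ultimately show False using not_less_Least[of k P] unfolding d_def by blast
    qed
  qed
  then show ?thesis using \<rho>z by (rule that)
qed

section \<open>Characters\<close>

lemma mat_mult_entry:
  assumes "A \<in> carrier_mat n m" "B \<in> carrier_mat m k" "i < n" "j < k"
  shows "(A * B) $$ (i, j) = (\<Sum>l<m. A $$ (i, l) * B $$ (l, j))"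
  using assms by (simp add: scalar_prod_def atLeast0LessThan)

lemma mat_trace_mult_commute:
  assumes "A \<in> carrier_mat n m" "B \<in> carrier_mat m n"
  shows "mat_trace (A * B) = mat_trace (B * A)"
proof -
  have "mat_trace (A * B) = (\<Sum>i<n. \<Sum>l<m. A $$ (i, l) * B $$ (l, i))"
    using assms mat_mult_entry[OF assms] by (simp add: mat_trace_def del: index_mult_mat(1))
  also have "\<dots> = (\<Sum>l<m. \<Sum>i<n. B $$ (l, i) * A $$ (i, l))"
    by (subst sum.swap) (simp add: mult.commute)
  also have "\<dots> = mat_trace (B * A)"
    using assms mat_mult_entry[OF assms(2,1)] by (simp add: mat_trace_def del: index_mult_mat(1))
  finally show ?thesis .
qed

lemma mat_trace_scalar: "mat_trace (c \<cdot>\<^sub>m 1\<^sub>m n) = of_nat n * c"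
  by (simp add: mat_trace_def)

lemma mat_trace_smult:
  assumes "A \<in> carrier_mat n n" shows "mat_trace (c \<cdot>\<^sub>m A) = c * mat_trace A"
  using assms by (simp add: mat_trace_def sum_distrib_left)

text \<open>Averaging the matrix unit E at position (i, k) over the group gives a matrix commuting
  with \<rho>, hence a scalar matrix by Schur. Its trace fixes the scalar, and its entry (i, k) is
  the sum in question.\<close>

lemma (in group) irreducible_rep_diagonal_orthogonality:
  assumes fin: "finite (carrier G)" and irr: "irreducible_rep G d \<rho>" and i: "i < d" and k: "k < d"
  shows "(\<Sum>g \<in> carrier G. \<rho> g $$ (i, i) * \<rho> (inv g) $$ (k, k))
           = (if i = k then of_nat (Coset.order G) / of_nat d else 0)"
proof -
  have d: "d > 0" and r: "matrix_rep G d \<rho>" using irr unfolding irreducible_rep_iff by auto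
  note D = matrix_repD[OF r]
  have \<rho>_mult: "(\<Sum>j<d. \<rho> g $$ (r, j) * \<rho> h $$ (j, s)) = \<rho> (g \<otimes> h) $$ (r, s)"
    if "g \<in> carrier G" "h \<in> carrier G" "r < d" "s < d" for g h r s
    using mat_mult_entry[of "\<rho> g" d d "\<rho> h" d r s] D(1,3) that by simp
  \<comment> \<open>\<open>T\<close> is the sum of \<rho>(g) E \<rho>(g^-1), written out in
    entries.\<close>
  define T where "T = mat d d (\<lambda>(r, s). \<Sum>g \<in> carrier G. \<rho> g $$ (r, i) * \<rho> (inv g) $$ (k, s))"
  have T: "T \<in> carrier_mat d d" by (simp add: T_def)
  have "\<rho> h * T = T * \<rho> h" if h: "h \<in> carrier G" for h
  proof (rule eq_matI)
    fix r s assume "r < dim_row (T * \<rho> h)" "s < dim_col (T * \<rho> h)"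
    then have r: "r < d" and s: "s < d" using T D(1)[OF h] by auto
    have "(\<rho> h * T) $$ (r, s)
        = (\<Sum>j<d. \<Sum>g \<in> carrier G. \<rho> h $$ (r, j) * \<rho> g $$ (j, i) * \<rho> (inv g) $$ (k, s))"
      using mat_mult_entry[OF D(1)[OF h] T r s] s
      by (simp add: T_def sum_distrib_left mult.assoc)
    also have "\<dots> = (\<Sum>g \<in> carrier G. (\<Sum>j<d. \<rho> h $$ (r, j) * \<rho> g $$ (j, i)) * \<rho> (inv g) $$ (k, s))"
      by (subst sum.swap) (simp add: sum_distrib_right)
    \<comment> \<open>Writing g^-1 as (hg)^-1 h prepares the substitution of g for hg, which moves h
      to the right-hand factor.\<close>
    also have "\<dots> = (\<Sum>g \<in> carrier G. \<rho> (h \<otimes> g) $$ (r, i) * \<rho> (inv (h \<otimes> g) \<otimes> h) $$ (k, s))"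
    proof (rule sum.cong[OF refl])
      fix g assume g: "g \<in> carrier G"
      have "inv (h \<otimes> g) \<otimes> h = inv g" using g h by (simp add: inv_mult_group m_assoc)
      then show "(\<Sum>j<d. \<rho> h $$ (r, j) * \<rho> g $$ (j, i)) * \<rho> (inv g) $$ (k, s)
          = \<rho> (h \<otimes> g) $$ (r, i) * \<rho> (inv (h \<otimes> g) \<otimes> h) $$ (k, s)"
        using \<rho>_mult[OF h g r i] by simp
    qed
    also have "\<dots> = (\<Sum>g \<in> carrier G. \<rho> g $$ (r, i) * \<rho> (inv g \<otimes> h) $$ (k, s))"
    proof (rule sum.reindex_bij_witness[where i = "\<lambda>g. inv h \<otimes> g" and j = "\<lambda>g. h \<otimes> g"])
    qed (use h in \<open>simp_all add: m_assoc[symmetric]\<close>)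
    also have "\<dots> = (\<Sum>g \<in> carrier G. \<Sum>j<d. \<rho> g $$ (r, i) * \<rho> (inv g) $$ (k, j) * \<rho> h $$ (j, s))"
    proof (rule sum.cong[OF refl])
      fix g assume g: "g \<in> carrier G"
      show "\<rho> g $$ (r, i) * \<rho> (inv g \<otimes> h) $$ (k, s)
          = (\<Sum>j<d. \<rho> g $$ (r, i) * \<rho> (inv g) $$ (k, j) * \<rho> h $$ (j, s))"
        unfolding \<rho>_mult[OF inv_closed[OF g] h k s, symmetric]
        by (simp add: sum_distrib_left mult.assoc)
    qed
    also have "\<dots> = (T * \<rho> h) $$ (r, s)"
      using mat_mult_entry[OF T D(1)[OF h] r s] r
      by (subst sum.swap) (simp add: T_def sum_distrib_right)
    finally show "(\<rho> h * T) $$ (r, s) = (T * \<rho> h) $$ (r, s)" .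
  qed (use T D(1)[OF h] in auto)
  then obtain c where c: "T = c \<cdot>\<^sub>m 1\<^sub>m d" using schur_scalar[OF irr T] by metis
  have "of_nat d * c = mat_trace T" by (simp add: c mat_trace_scalar)
  also have "\<dots> = (\<Sum>g \<in> carrier G. \<Sum>r<d. \<rho> (inv g) $$ (k, r) * \<rho> g $$ (r, i))"
    by (subst sum.swap) (simp add: T_def mat_trace_def mult.commute)
  also have "\<dots> = (\<Sum>g \<in> carrier G. if i = k then 1 else 0)"
    using \<rho>_mult[OF _ _ k i] D(2) i k by (intro sum.cong refl) auto
  finally have "c = (if i = k then of_nat (Coset.order G) / of_nat d else 0)"
    using d by (auto simp: field_simps Coset.order_def)
  moreover have "(\<Sum>g \<in> carrier G. \<rho> g $$ (i, i) * \<rho> (inv g) $$ (k, k)) = T $$ (i, k)"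
    using i k by (simp add: T_def)
  ultimately show ?thesis using i k by (simp add: c)
qed

text \<open>Expanding both traces, only the d diagonal pairs i = k survive, and each contributes
  |G|/d.\<close>

lemma (in group) irreducible_character_norm:
  assumes fin: "finite (carrier G)" and irr: "irreducible_rep G d \<rho>"
  shows "(\<Sum>g \<in> carrier G. mat_trace (\<rho> g) * mat_trace (\<rho> (inv g))) = of_nat (Coset.order G)"
proof -
  have d: "d > 0" and r: "matrix_rep G d \<rho>" using irr unfolding irreducible_rep_iff by auto
  have dim: "dim_row (\<rho> g) = d" if "g \<in> carrier G" for g
    using matrix_repD(1)[OF r that] by simp
  have "(\<Sum>g \<in> carrier G. mat_trace (\<rho> g) * mat_trace (\<rho> (inv g)))
      = (\<Sum>g \<in> carrier G. \<Sum>i<d. \<Sum>k<d. \<rho> g $$ (i, i) * \<rho> (inv g) $$ (k, k))"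
    by (intro sum.cong refl) (simp add: mat_trace_def dim sum_product)
  also have "\<dots> = (\<Sum>i<d. \<Sum>k<d. \<Sum>g \<in> carrier G. \<rho> g $$ (i, i) * \<rho> (inv g) $$ (k, k))"
    by (subst sum.swap) (intro sum.cong refl sum.swap)
  also have "\<dots> = (\<Sum>i<d. \<Sum>k<d. if i = k then of_nat (Coset.order G) / of_nat d else 0)"
    using irreducible_rep_diagonal_orthogonality[OF fin irr] by (intro sum.cong refl) auto
  also have "\<dots> = of_nat (Coset.order G)" using d by simp
  finally show ?thesis .
qed

section \<open>Linear characters and their column sums\<close>

text \<open>Extensional like \<open>rep_character\<close>, so that linear characters are literally
  elements of \<open>Irr G\<close>. The value 1 at the identity excludes the zero function.\<close>

definition linear_chars :: "('a, 'b) monoid_scheme \<Rightarrow> ('a \<Rightarrow> complex) set" where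
  "linear_chars G = {\<phi> \<in> extensional (carrier G). \<phi> \<one>\<^bsub>G\<^esub> = 1 \<and>
     (\<forall>x \<in> carrier G. \<forall>y \<in> carrier G. \<phi> (x \<otimes>\<^bsub>G\<^esub> y) = \<phi> x * \<phi> y)}"

lemma linear_charsD:
  assumes "\<phi> \<in> linear_chars G"
  shows "\<phi> \<in> extensional (carrier G)" "\<phi> \<one>\<^bsub>G\<^esub> = 1"
    and "\<And>x y. x \<in> carrier G \<Longrightarrow> y \<in> carrier G \<Longrightarrow> \<phi> (x \<otimes>\<^bsub>G\<^esub> y) = \<phi> x * \<phi> y"
  using assms unfolding linear_chars_def by auto

lemma restrict_in_linear_chars:
  assumes "group G" "f \<one>\<^bsub>G\<^esub> = 1"
    and "\<And>x y. x \<in> carrier G \<Longrightarrow> y \<in> carrier G \<Longrightarrow> f (x \<otimes>\<^bsub>G\<^esub> y) = f x * f y"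
  shows "(\<lambda>x \<in> carrier G. f x) \<in> linear_chars G"
proof -
  interpret group G by fact
  show ?thesis using assms(2,3) by (auto simp: linear_chars_def)
qed

lemma (in group) linear_char_pow:
  assumes "\<phi> \<in> linear_chars G" "x \<in> carrier G"
  shows "\<phi> (x [^] (n::nat)) = \<phi> x ^ n"
  using assms by (induction n) (auto simp: linear_charsD)

lemma (in group) linear_char_pow_order:
  assumes "\<phi> \<in> linear_chars G" "x \<in> carrier G"
  shows "\<phi> x ^ Coset.order G = 1"
  using linear_char_pow[OF assms, of "Coset.order G"] assms
  by (simp add: pow_order_eq_1 linear_charsD)

lemma (in group) norm_linear_char:
  assumes "finite (carrier G)" "\<phi> \<in> linear_chars G" "x \<in> carrier G"
  shows "cmod (\<phi> x) = 1"
proof -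
  have "Coset.order G > 0" using assms(1) by (simp add: order_gt_0_iff_finite)
  then show ?thesis
    using power_eq_1_iff[OF linear_char_pow_order[OF assms(2,3)]] by auto
qed

lemma (in group) linear_char_inv:
  assumes "finite (carrier G)" "\<phi> \<in> linear_chars G" "x \<in> carrier G"
  shows "\<phi> (inv x) = cnj (\<phi> x)"
proof -
  have 1: "\<phi> x * \<phi> (inv x) = 1" using linear_charsD(2,3)[OF assms(2)] assms(3) by (metis inv_closed r_inv)
  have 2: "\<phi> x * cnj (\<phi> x) = 1"
    using norm_linear_char[OF assms] complex_norm_square[of "\<phi> x"] by simp
  have "\<phi> x \<noteq> 0" using 1 by auto
  then show ?thesis using 1 2 by (metis mult_left_cancel)
qed

text \<open>All values are roots of unity of order dividing |G|, so there are finitely many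
  candidate functions on the carrier.\<close>

lemma (in group) finite_linear_chars:
  assumes "finite (carrier G)"
  shows "finite (linear_chars G)"
proof (rule finite_subset)
  have "Coset.order G > 0" using assms(1) by (simp add: order_gt_0_iff_finite)
  then show "finite (carrier G \<rightarrow>\<^sub>E {z::complex. z ^ Coset.order G = 1})"
    using assms by (intro finite_PiE) (auto intro!: finite_roots_unity)
  show "linear_chars G \<subseteq> carrier G \<rightarrow>\<^sub>E {z. z ^ Coset.order G = 1}"
    using linear_char_pow_order by (auto simp: PiE_def linear_charsD)
qed

text \<open>Multiplication by a linear character with nontrivial value at \<open>a\<close> permutes the linear
  characters, which forces the sum to vanish; the number of linear characters then comes out of
  summing over all group elements.\<close>

lemma (in group) linear_chars_sum:
  assumes fin: "finite (carrier G)" and N: "N \<subseteq> carrier G" "\<one> \<in> N"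
    and triv: "\<And>\<phi> a. \<phi> \<in> linear_chars G \<Longrightarrow> a \<in> N \<Longrightarrow> \<phi> a = 1"
    and sep: "\<And>a. a \<in> carrier G \<Longrightarrow> a \<notin> N \<Longrightarrow> \<exists>\<phi> \<in> linear_chars G. \<phi> a \<noteq> 1"
    and a: "a \<in> carrier G"
  shows "(\<Sum>\<phi> \<in> linear_chars G. \<phi> a)
           = (if a \<in> N then of_nat (Coset.order G) / of_nat (card N) else 0)"
proof -
  let ?L = "linear_chars G"
  have zero: "(\<Sum>\<phi> \<in> ?L. \<phi> a) = 0" if a: "a \<in> carrier G" "a \<notin> N" for a
  proof -
    obtain \<psi> where \<psi>: "\<psi> \<in> ?L" "\<psi> a \<noteq> 1" using sep a by auto
    have \<psi>0: "\<psi> x \<noteq> 0" if "x \<in> carrier G" for x using norm_linear_char[OF fin \<psi>(1) that] by auto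
    have ext: "(\<lambda>x \<in> carrier G. \<phi> x) = \<phi>" if "\<phi> \<in> ?L" for \<phi>
      using linear_charsD(1)[OF that] by (rule extensional_restrict)
    have "(\<Sum>\<phi> \<in> ?L. \<phi> a) = (\<Sum>\<phi> \<in> ?L. \<psi> a * \<phi> a)"
    proof (rule sum.reindex_bij_witness[where i = "\<lambda>\<phi>. \<lambda>x \<in> carrier G. \<psi> x * \<phi> x"
          and j = "\<lambda>\<phi>. \<lambda>x \<in> carrier G. \<phi> x / \<psi> x"])
      fix \<phi> assume \<phi>: "\<phi> \<in> ?L"
      show "(\<lambda>x \<in> carrier G. \<psi> x * (\<lambda>x \<in> carrier G. \<phi> x / \<psi> x) x) = \<phi>"
        using ext[OF \<phi>] \<psi>0 by (simp cong: restrict_cong)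
      show "(\<lambda>x \<in> carrier G. (\<lambda>x \<in> carrier G. \<psi> x * \<phi> x) x / \<psi> x) = \<phi>"
        using ext[OF \<phi>] \<psi>0 by (simp cong: restrict_cong)
      show "(\<lambda>x \<in> carrier G. \<phi> x / \<psi> x) \<in> ?L" "(\<lambda>x \<in> carrier G. \<psi> x * \<phi> x) \<in> ?L"
        using linear_charsD(2,3)[OF \<phi>] linear_charsD(2,3)[OF \<psi>(1)] is_group
        by (auto intro!: restrict_in_linear_chars)
      show "\<psi> a * (\<lambda>x \<in> carrier G. \<phi> x / \<psi> x) a = \<phi> a" using a \<psi>0 by simp
    qed
    also have "\<dots> = \<psi> a * (\<Sum>\<phi> \<in> ?L. \<phi> a)" by (simp add: sum_distrib_left)
    finally show ?thesis using \<psi>(2) by simp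
  qed
  have one: "(\<Sum>\<phi> \<in> ?L. \<phi> a) = of_nat (card ?L)" if "a \<in> N" for a
    by (subst sum.cong[OF refl, of _ _ "\<lambda>_. 1"]) (use triv that in auto)
  define \<epsilon> :: "'a \<Rightarrow> complex" where "\<epsilon> = (\<lambda>x \<in> carrier G. 1)"
  have \<epsilon>: "\<epsilon> \<in> ?L" unfolding \<epsilon>_def by (rule restrict_in_linear_chars) (auto intro: is_group)
  have row: "(\<Sum>x \<in> carrier G. \<phi> x) = (if \<phi> = \<epsilon> then of_nat (Coset.order G) else 0)"
    if \<phi>: "\<phi> \<in> ?L" for \<phi>
  proof (cases "\<phi> = \<epsilon>")
    case True
    then show ?thesis by (simp add: \<epsilon>_def Coset.order_def)
  next
    case False
    have "\<exists>b \<in> carrier G. \<phi> b \<noteq> 1"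
    proof (rule ccontr)
      assume "\<not> ?thesis"
      then have "\<phi> = \<epsilon>"
        using linear_charsD(1)[OF \<phi>] by (intro extensionalityI[where A = "carrier G"]) (auto simp: \<epsilon>_def)
      then show False using False by simp
    qed
    then obtain b where b: "b \<in> carrier G" "\<phi> b \<noteq> 1" by auto
    have "(\<Sum>x \<in> carrier G. \<phi> x) = (\<Sum>x \<in> carrier G. \<phi> b * \<phi> x)"
      by (rule sum.reindex_bij_witness[where i = "\<lambda>x. b \<otimes> x" and j = "\<lambda>x. inv b \<otimes> x"])
        (use b linear_charsD(3)[OF \<phi>] in \<open>simp_all add: m_assoc[symmetric] flip: linear_charsD(3)[OF \<phi>]\<close>)
    also have "\<dots> = \<phi> b * (\<Sum>x \<in> carrier G. \<phi> x)" by (simp add: sum_distrib_left)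
    finally show ?thesis using b False by simp
  qed
  have "of_nat (card N) * of_nat (card ?L) = (\<Sum>a \<in> carrier G. if a \<in> N then of_nat (card ?L) else (0::complex))"
    using fin N by (simp add: sum.If_cases Int_absorb1)
  also have "\<dots> = (\<Sum>a \<in> carrier G. \<Sum>\<phi> \<in> ?L. \<phi> a)"
    using zero one by (intro sum.cong) auto
  also have "\<dots> = (\<Sum>\<phi> \<in> ?L. \<Sum>a \<in> carrier G. \<phi> a)" by (rule sum.swap)
  also have "\<dots> = of_nat (Coset.order G)" using row \<epsilon> finite_linear_chars[OF fin] by simp
  finally have "of_nat (card N) * (of_nat (card ?L) :: complex) = of_nat (Coset.order G)" .
  moreover have "card N \<noteq> 0" using N fin by (metis card_eq_0_iff empty_iff finite_subset)
  ultimately have "(of_nat (card ?L) :: complex) = of_nat (Coset.order G) / of_nat (card N)"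
    by (simp add: field_simps)
  then show ?thesis using zero[OF a] one[of a] by simp
qed

text \<open>Scalar matrices preserve every subspace. In dimension above one, the hyperplane where
  the coordinate with index 1 vanishes is proper and nonzero.\<close>

lemma (in group) irreducible_rep_all_scalar:
  assumes irr: "irreducible_rep G d \<rho>"
    and scal: "\<And>g. g \<in> carrier G \<Longrightarrow> \<exists>c. \<rho> g = c \<cdot>\<^sub>m 1\<^sub>m d"
  shows "d = 1"
proof (rule ccontr)
  assume "d \<noteq> 1"
  have d: "d > 0" and simple: "\<And>W. VectorSpace.subspace class_ring W (module_vec TYPE(complex) d) \<Longrightarrow>
          (\<forall>g \<in> carrier G. \<forall>w \<in> W. \<rho> g *\<^sub>v w \<in> W) \<Longrightarrow> W = {0\<^sub>v d} \<or> W = carrier_vec d"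
    using irr unfolding irreducible_rep_iff by auto
  then have d1: "1 < d" using \<open>d \<noteq> 1\<close> by simp
  define W where "W = {v :: complex vec. v \<in> carrier_vec d \<and> v $ 1 = 0}"
  have W: "VectorSpace.subspace class_ring W (module_vec TYPE(complex) d)"
    by (rule subspaceI) (use d1 in \<open>auto simp: W_def\<close>)
  have "\<rho> g *\<^sub>v w \<in> W" if g: "g \<in> carrier G" and w: "w \<in> W" for g w
  proof -
    obtain c where "\<rho> g = c \<cdot>\<^sub>m 1\<^sub>m d" using scal[OF g] by auto
    then have "\<rho> g *\<^sub>v w = c \<cdot>\<^sub>v w" using w by (simp add: W_def scalar_mat_mult_vec)
    then show ?thesis using subspaceD(4)[OF W w] by simp
  qed
  then have "W = {0\<^sub>v d} \<or> W = carrier_vec d" using simple[OF W] by blast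
  moreover have "unit_vec d 0 \<in> W" "unit_vec d 0 \<noteq> 0\<^sub>v d" using d d1 by (auto simp: W_def)
  moreover have "unit_vec d 1 \<in> carrier_vec d" "unit_vec d 1 \<notin> W" using d1 by (auto simp: W_def)
  ultimately show False by blast
qed

lemma (in group) irreducible_rep_one_dim:
  assumes "irreducible_rep G 1 \<rho>"
  shows "rep_character G \<rho> \<in> linear_chars G"
proof -
  have r: "matrix_rep G 1 \<rho>" using assms unfolding irreducible_rep_iff by auto
  note D = matrix_repD[OF r]
  have tr: "mat_trace A = A $$ (0, 0)" if "A \<in> carrier_mat 1 1" for A
    using that by (simp add: mat_trace_def)
  show ?thesis
    unfolding rep_character_def
  proof (rule restrict_in_linear_chars[OF is_group])
    show "mat_trace (\<rho> \<one>) = 1" using D(2) by (simp add: tr)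
    fix x y assume x: "x \<in> carrier G" and y: "y \<in> carrier G"
    have "\<rho> x * \<rho> y \<in> carrier_mat 1 1" using mult_carrier_mat[OF D(1)[OF x] D(1)[OF y]] .
    then show "mat_trace (\<rho> (x \<otimes> y)) = mat_trace (\<rho> x) * mat_trace (\<rho> y)"
      using D(1)[OF x] D(1)[OF y] D(3)[OF x y]
      by (simp add: tr mat_mult_entry[OF D(1)[OF x] D(1)[OF y]] del: index_mult_mat(1))
  qed
qed

lemma (in group) linear_chars_subset_Irr: "linear_chars G \<subseteq> Irr G"
proof
  fix \<phi> assume \<phi>: "\<phi> \<in> linear_chars G"
  define \<rho> where "\<rho> = (\<lambda>g. \<phi> g \<cdot>\<^sub>m 1\<^sub>m 1)"
  have r: "matrix_rep G 1 \<rho>"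
    using linear_charsD(2,3)[OF \<phi>] by (auto simp: matrix_rep_def \<rho>_def)
  have "irreducible_rep G 1 \<rho>"
    unfolding irreducible_rep_iff
  proof (intro conjI allI impI r)
    fix W assume W: "VectorSpace.subspace class_ring W (module_vec TYPE(complex) 1)"
    show "W = {0\<^sub>v 1} \<or> W = carrier_vec 1"
    proof (rule ccontr)
      assume n: "\<not> (W = {0\<^sub>v 1} \<or> W = carrier_vec 1)"
      then obtain w where w: "w \<in> W" "w \<noteq> 0\<^sub>v 1" using subspaceD(2)[OF W] by auto
      have wc: "w \<in> carrier_vec 1" using subspaceD(1)[OF W] w by auto
      have w0: "w $ 0 \<noteq> 0"
      proof
        assume "w $ 0 = 0"
        then have "w = 0\<^sub>v 1" using wc by (intro eq_vecI) auto
        then show False using w by simp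
      qed
      have "v \<in> W" if v: "v \<in> carrier_vec 1" for v
      proof -
        have "v = (v $ 0 / w $ 0) \<cdot>\<^sub>v w" using v wc w0 by (intro eq_vecI) auto
        then show ?thesis using subspaceD(4)[OF W w(1)] by metis
      qed
      then show False using n subspaceD(1)[OF W] by auto
    qed
  qed simp
  moreover have "rep_character G \<rho> = \<phi>"
    using linear_charsD(1)[OF \<phi>]
    by (intro extensionalityI[where A = "carrier G"]) (auto simp: rep_character_def \<rho>_def mat_trace_scalar)
  ultimately show "\<phi> \<in> Irr G" unfolding Irr_def by blast
qed

text \<open>In an abelian group every element is central, so some irreducible representation lets a
  act by a prescribed root of unity other than 1. By Schur all its matrices are scalar, hence it is
  one-dimensional.\<close>

lemma (in comm_group) linear_chars_separate:
  assumes fin: "finite (carrier G)" and a: "a \<in> carrier G" "a \<noteq> \<one>"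
  obtains \<phi> where "\<phi> \<in> linear_chars G" "\<phi> a \<noteq> 1"
proof -
  have "ord a > 0" using ord_ge_1[OF fin a(1)] by simp
  moreover have "ord a \<noteq> 1" using ord_eq_1 a by blast
  ultimately have ord: "ord a > 1" by linarith
  define \<zeta> where "\<zeta> = cis (2 * pi / real (ord a))"
  have "\<zeta> ^ ord a = 1" using ord by (simp add: \<zeta>_def DeMoivre)
  moreover have "\<zeta> \<noteq> 1"
  proof
    assume "\<zeta> = 1"
    then have "cos (2 * pi / real (ord a)) = 1" by (metis \<zeta>_def cis.sel(1) one_complex.sel(1))
    then obtain n :: int where "2 * pi / real (ord a) = of_int n * 2 * pi" by (auto simp: cos_one_2pi_int)
    then have "1 = of_int n * real (ord a)" using ord by (simp add: field_simps)
    then have "of_int 1 = (of_int (n * int (ord a)) :: real)" by simp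
    then have "n * int (ord a) = 1" by (metis of_int_eq_iff)
    then show False using ord by (auto simp: zmult_eq_1_iff)
  qed
  moreover obtain d \<rho> where irr: "irreducible_rep G d \<rho>" and \<rho>a: "\<rho> a = \<zeta> \<cdot>\<^sub>m 1\<^sub>m d"
    by (rule exists_irreducible_rep_scalar[OF fin a(1) _ \<open>\<zeta> ^ ord a = 1\<close>])
      (use a m_comm in auto)
  have r: "matrix_rep G d \<rho>" using irr unfolding irreducible_rep_iff by auto
  have "\<exists>c. \<rho> g = c \<cdot>\<^sub>m 1\<^sub>m d" if g: "g \<in> carrier G" for g
  proof -
    have "\<rho> h * \<rho> g = \<rho> g * \<rho> h" if "h \<in> carrier G" for h
      using matrix_repD(3)[OF r] g that m_comm by metis
    then show ?thesis using schur_scalar[OF irr matrix_repD(1)[OF r g]] by metis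
  qed
  then have "d = 1" by (rule irreducible_rep_all_scalar[OF irr])
  then have "rep_character G \<rho> \<in> linear_chars G" using irreducible_rep_one_dim irr by simp
  moreover have "rep_character G \<rho> a = \<zeta>" using a \<rho>a \<open>d = 1\<close> by (simp add: rep_character_def mat_trace_scalar)
  ultimately show ?thesis using that by metis
qed

section \<open>Extraspecial groups\<close>

lemma (in group) prime_order_generated:
  assumes prime: "Factorial_Ring.prime (Coset.order G)"
    and z: "z \<in> carrier G" "z \<noteq> \<one>" and w: "w \<in> carrier G"
  obtains k :: nat where "w = z [^] k"
proof -
  have fin: "finite (carrier G)"
    using prime_gt_0_nat[OF prime] by (simp add: order_gt_0_iff_finite)
  have "ord z dvd Coset.order G" using z(1) by (rule ord_dvd_group_order)
  moreover have "ord z \<noteq> 1" using ord_eq_1 z by blast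
  ultimately have "ord z = Coset.order G" using prime unfolding prime_nat_iff by blast
  then have "card (generate G {z}) = card (carrier G)"
    using generate_pow_card[OF z(1)] by (simp add: Coset.order_def)
  moreover have "generate G {z} \<subseteq> carrier G" using generate_in_carrier[of "{z}"] z(1) by auto
  ultimately have "generate G {z} = carrier G" using fin card_subset_eq by metis
  then show ?thesis using w generate_pow_on_finite_carrier[OF fin z(1)] that by auto
qed

lemma (in group) rep_trace_conj:
  assumes r: "matrix_rep G d \<rho>" and g: "g \<in> carrier G" and x: "x \<in> carrier G"
  shows "mat_trace (\<rho> (g \<otimes> x \<otimes> inv g)) = mat_trace (\<rho> x)"
proof -
  note D = matrix_repD[OF r]
  have "mat_trace (\<rho> (g \<otimes> x \<otimes> inv g)) = mat_trace (\<rho> (g \<otimes> x) * \<rho> (inv g))"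
    using D(3) g x by simp
  also have "\<dots> = mat_trace (\<rho> (inv g) * \<rho> (g \<otimes> x))"
    using mat_trace_mult_commute[OF D(1) D(1)] g x by simp
  also have "\<rho> (inv g) * \<rho> (g \<otimes> x) = \<rho> (inv g \<otimes> (g \<otimes> x))" using D(3) g x by simp
  also have "inv g \<otimes> (g \<otimes> x) = x" using g x by (simp add: m_assoc[symmetric])
  finally show ?thesis .
qed

section \<open>The centre, commutators and linear characters of an extraspecial group\<close>

lemma group_centerD:
  assumes "z \<in> group_center G"
  shows "z \<in> carrier G" and "g \<in> carrier G \<Longrightarrow> z \<otimes>\<^bsub>G\<^esub> g = g \<otimes>\<^bsub>G\<^esub> z"
  using assms unfolding group_center_def by blast+

lemma group_centerI:
  assumes "z \<in> carrier G" "\<And>g. g \<in> carrier G \<Longrightarrow> z \<otimes>\<^bsub>G\<^esub> g = g \<otimes>\<^bsub>G\<^esub> z"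
  shows "z \<in> group_center G"
  using assms unfolding group_center_def by blast

lemma (in group) group_center_subgroup: "subgroup (group_center G) G"
proof (rule subgroupI)
  have "\<one> \<in> group_center G" by (rule group_centerI) auto
  then show "group_center G \<noteq> {}" by blast
  show "inv a \<in> group_center G" if a: "a \<in> group_center G" for a
  proof (rule group_centerI)
    fix g assume g: "g \<in> carrier G"
    have "inv (a \<otimes> inv g) = inv (inv g \<otimes> a)" using group_centerD(2)[OF a inv_closed[OF g]] by simp
    then show "inv a \<otimes> g = g \<otimes> inv a" using group_centerD(1)[OF a] g by (simp add: inv_mult_group)
  qed (use group_centerD(1)[OF a] in simp)
  show "a \<otimes> b \<in> group_center G" if a: "a \<in> group_center G" and b: "b \<in> group_center G" for a b
  proof (rule group_centerI)
    fix g assume g: "g \<in> carrier G"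
    then show "a \<otimes> b \<otimes> g = g \<otimes> (a \<otimes> b)"
      using group_centerD[OF a] group_centerD[OF b] by (metis m_assoc)
  qed (use group_centerD(1)[OF a] group_centerD(1)[OF b] in simp)
qed (auto dest: group_centerD(1))

lemma (in group) group_center_normal: "group_center G \<lhd> G"
  unfolding normal_inv_iff
proof (intro conjI ballI group_center_subgroup)
  fix x h assume x: "x \<in> carrier G" and h: "h \<in> group_center G"
  have "x \<otimes> h = h \<otimes> x" using group_centerD(2)[OF h x] by (rule sym)
  then have "x \<otimes> h \<otimes> inv x = h" using x group_centerD(1)[OF h] by (simp add: m_assoc)
  then show "x \<otimes> h \<otimes> inv x \<in> group_center G" using h by simp
qed

text \<open>\<open>p_extraspecial\<close> only asserts that some exponent exists; the locale fixes
  the \<open>n\<close> that occurs in the formula.\<close>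

locale extraspecial_group = group G for G (structure) +
  fixes p n :: nat
  assumes prime_p: "Factorial_Ring.prime p" and extra: "p_extraspecial p G"
    and order: "Coset.order G = p ^ (2 * n + 1)"
begin

abbreviation Z where "Z \<equiv> group_center G"
abbreviation H where "H \<equiv> G\<lparr>carrier := Z\<rparr>"

lemma fin: "finite (carrier G)" and card_Z: "card Z = p"
  and card_derived: "card (derived G (carrier G)) = p" and quot: "comm_group (G Mod Z)"
  using extra by (auto simp: p_extraspecial_def)

lemma p_pos: "p > 0" using prime_gt_0_nat[OF prime_p] .

sublocale Z: subgroup Z G by (rule group_center_subgroup)
sublocale Z: normal Z G by (rule group_center_normal)
sublocale H: comm_group H
proof (rule group.group_comm_groupI)
  show "group H" by (rule Z.subgroup_is_group[OF is_group])
  show "x \<otimes>\<^bsub>H\<^esub> y = y \<otimes>\<^bsub>H\<^esub> x" if "x \<in> carrier H" "y \<in> carrier H" for x y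
    using that group_centerD by fastforce
qed

lemmas Z_comm = group_centerD(2)

lemma fin_Z: "finite Z" using fin Z.subset by (rule finite_subset[rotated])

lemma order_H: "Coset.order H = p" by (simp add: Coset.order_def card_Z)

lemma H_pow: "x [^]\<^bsub>H\<^esub> (k::nat) = x [^] k"
  by (rule nat_pow_consistent[symmetric])

lemma Z_generated:
  assumes "z \<in> Z" "z \<noteq> \<one>" "w \<in> Z"
  obtains k :: nat where "w = z [^] k"
proof -
  have "Factorial_Ring.prime (Coset.order H)" using prime_p order_H by simp
  then obtain k :: nat where "w = z [^]\<^bsub>H\<^esub> k"
    using assms by (elim H.prime_order_generated[of z w]) auto
  then show ?thesis using that H_pow by simp
qed

text \<open>The element z is the commutator of x and y: both products lie in the same coset of the
  centre because the quotient is abelian.\<close>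

lemma commute_up_to_Z:
  assumes x: "x \<in> carrier G" and y: "y \<in> carrier G"
  obtains z where "z \<in> Z" "x \<otimes> y = z \<otimes> (y \<otimes> x)"
proof -
  interpret Q: comm_group "G Mod Z" by (rule quot)
  have "Z #> (x \<otimes> y) = Z #> (y \<otimes> x)"
    using Q.m_comm[of "Z #> x" "Z #> y"] x y by (simp add: Z.rcos_sum carrier_FactGroup)
  moreover have "x \<otimes> y \<in> Z #> (x \<otimes> y)" using x y by (simp add: rcos_self Z.subgroup_axioms)
  ultimately have "x \<otimes> y \<in> Z #> (y \<otimes> x)" by simp
  then show ?thesis using that by (auto simp: r_coset_def)
qed

text \<open>An abelian group has trivial derived subgroup, while here it has p > 1 elements.\<close>

lemma exists_noncommuting:
  obtains x y where "x \<in> carrier G" "y \<in> carrier G" "x \<otimes> y \<noteq> y \<otimes> x"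
proof (rule ccontr)
  assume "\<not> thesis"
  then have "comm_group G" using that by (intro group_comm_groupI) blast
  then have "derived G (carrier G) = {\<one>}" by (rule comm_group.derived_eq_singleton) simp
  then have "p = 1" using card_derived by simp
  then show False using prime_p by simp
qed

text \<open>A linear character is 1 on commutators. Some commutator is a nontrivial element of the
  centre, and it generates the centre because p is prime.\<close>

lemma linear_char_center:
  assumes \<phi>: "\<phi> \<in> linear_chars G" and a: "a \<in> Z"
  shows "\<phi> a = 1"
proof -
  obtain x y where x: "x \<in> carrier G" and y: "y \<in> carrier G" and xy: "x \<otimes> y \<noteq> y \<otimes> x"
    by (rule exists_noncommuting)
  obtain z where z: "z \<in> Z" "x \<otimes> y = z \<otimes> (y \<otimes> x)" using commute_up_to_Z[OF x y] .
  have z1: "z \<noteq> \<one>" using z xy x y by auto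
  have zc: "z \<in> carrier G" using z(1) by simp
  have "\<phi> x * \<phi> y = \<phi> z * (\<phi> y * \<phi> x)"
    using linear_charsD(3)[OF \<phi>] z(2) x y zc by (metis m_closed)
  moreover have "\<phi> x \<noteq> 0" "\<phi> y \<noteq> 0" using norm_linear_char[OF fin \<phi>] x y by force+
  ultimately have "\<phi> z = 1" by simp
  moreover obtain k :: nat where "a = z [^] k" using Z_generated[OF z(1) z1 a] .
  ultimately show ?thesis using linear_char_pow[OF \<phi> zc] by simp
qed

text \<open>A character of the abelian quotient that is not 1 on the coset of x is pulled back to
  the group.\<close>

lemma linear_chars_separate_cosets:
  assumes x: "x \<in> carrier G" and "x \<notin> Z"
  shows "\<exists>\<phi> \<in> linear_chars G. \<phi> x \<noteq> 1"
proof -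
  interpret Q: comm_group "G Mod Z" by (rule quot)
  have "finite (carrier (G Mod Z))" using fin by (simp add: carrier_FactGroup)
  moreover have "Z #> x \<in> carrier (G Mod Z)" using x by (simp add: carrier_FactGroup)
  moreover have "Z #> x \<noteq> \<one>\<^bsub>G Mod Z\<^esub>"
    using coset_join1[OF _ x group_center_subgroup] assms(2) by auto
  ultimately obtain \<phi> where \<phi>: "\<phi> \<in> linear_chars (G Mod Z)" "\<phi> (Z #> x) \<noteq> 1"
    using Q.linear_chars_separate by blast
  have "(\<lambda>g \<in> carrier G. \<phi> (Z #> g)) \<in> linear_chars G"
  proof (rule restrict_in_linear_chars[OF is_group])
    show "\<phi> (Z #> \<one>) = 1" using linear_charsD(2)[OF \<phi>(1)] by (simp add: Z.subset coset_mult_one)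
    fix g h assume "g \<in> carrier G" "h \<in> carrier G"
    then show "\<phi> (Z #> (g \<otimes> h)) = \<phi> (Z #> g) * \<phi> (Z #> h)"
      using linear_charsD(3)[OF \<phi>(1), of "Z #> g" "Z #> h"]
      by (simp add: Z.rcos_sum carrier_FactGroup)
  qed
  then show ?thesis using \<phi>(2) x by (intro bexI) auto
qed

lemma linear_chars_G_sum:
  assumes "a \<in> carrier G"
  shows "(\<Sum>\<phi> \<in> linear_chars G. \<phi> a) = (if a \<in> Z then of_nat (p ^ (2 * n)) else 0)"
proof -
  have "(\<Sum>\<phi> \<in> linear_chars G. \<phi> a)
      = (if a \<in> Z then of_nat (Coset.order G) / of_nat (card Z) else 0)"
    by (rule linear_chars_sum)
      (use fin Z.subset assms linear_char_center linear_chars_separate_cosets in auto)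
  then show ?thesis using p_pos by (simp add: order card_Z)
qed

lemma linear_chars_H_sum:
  assumes "a \<in> Z"
  shows "(\<Sum>\<omega> \<in> linear_chars H. \<omega> a) = (if a = \<one> then of_nat p else 0)"
proof -
  have "(\<Sum>\<omega> \<in> linear_chars H. \<omega> a)
      = (if a \<in> {\<one>} then of_nat (Coset.order H) / of_nat (card {\<one>}) else 0)"
  proof (rule H.linear_chars_sum)
    show "\<exists>\<omega> \<in> linear_chars H. \<omega> b \<noteq> 1" if "b \<in> carrier H" "b \<notin> {\<one>}" for b
      using H.linear_chars_separate[of b] that fin_Z by auto
    show "\<phi> b = 1" if "\<phi> \<in> linear_chars H" "b \<in> {\<one>}" for \<phi> b
      using that linear_charsD(2) by fastforce
  qed (use fin_Z assms in auto)
  then show ?thesis by (simp add: order_H)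
qed

section \<open>Classification of the irreducible characters\<close>

definition triv :: "'a \<Rightarrow> complex" where "triv = (\<lambda>z \<in> Z. 1)"

text \<open>For nontrivial \<omega> this turns out to be the only irreducible character with central
  character \<omega>; the factor \<open>p ^ n\<close> is its degree.\<close>

definition ext_char :: "('a \<Rightarrow> complex) \<Rightarrow> 'a \<Rightarrow> complex" where
  "ext_char \<omega> = (\<lambda>g \<in> carrier G. if g \<in> Z then of_nat (p ^ n) * \<omega> g else 0)"

lemma triv_linear_char: "triv \<in> linear_chars H"
  using restrict_in_linear_chars[OF H.is_group, of "\<lambda>_. 1"] by (simp add: triv_def)

text \<open>Any z other than the identity generates the centre, so one value determines
  \<omega>.\<close>

lemma linear_char_H_eqI:
  assumes \<omega>: "\<omega> \<in> linear_chars H" and \<omega>': "\<omega>' \<in> linear_chars H"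
    and z: "z \<in> Z" "z \<noteq> \<one>" and eq: "\<omega> z = \<omega>' z"
  shows "\<omega> = \<omega>'"
proof (rule extensionalityI[where A = Z])
  fix w assume w: "w \<in> Z"
  obtain k :: nat where "w = z [^] k" using Z_generated[OF z w] .
  then show "\<omega> w = \<omega>' w"
    using H.linear_char_pow[OF \<omega>, of z k] H.linear_char_pow[OF \<omega>', of z k] z(1) eq
    by (simp add: H_pow)
qed (use linear_charsD(1)[OF \<omega>] linear_charsD(1)[OF \<omega>'] in simp_all)

lemma faithful_if_nontrivial:
  assumes "\<omega> \<in> linear_chars H" "\<omega> \<noteq> triv" "z \<in> Z" "z \<noteq> \<one>"
  shows "\<omega> z \<noteq> 1"
  using linear_char_H_eqI[OF assms(1) triv_linear_char assms(3,4)] assms(2,3)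
  by (auto simp: triv_def)

text \<open>For an irreducible representation, central elements act by scalars, and any diagonal
  entry reads off the scalar. Entry (0, 0) always exists because the degree is positive.\<close>

definition central_char :: "('a \<Rightarrow> complex mat) \<Rightarrow> 'a \<Rightarrow> complex" where
  "central_char \<rho> = (\<lambda>z \<in> Z. \<rho> z $$ (0, 0))"

lemma central_char_eqI:
  assumes "d > 0" "z \<in> Z" "\<rho> z = c \<cdot>\<^sub>m 1\<^sub>m d"
  shows "central_char \<rho> z = c"
  using assms by (simp add: central_char_def)

lemma rep_center_scalar:
  assumes irr: "irreducible_rep G d \<rho>" and z: "z \<in> Z"
  shows "\<rho> z = central_char \<rho> z \<cdot>\<^sub>m 1\<^sub>m d"
proof -
  have d: "d > 0" and r: "matrix_rep G d \<rho>" using irr unfolding irreducible_rep_iff by auto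
  have zc: "z \<in> carrier G" using z by simp
  have "\<rho> g * \<rho> z = \<rho> z * \<rho> g" if "g \<in> carrier G" for g
    using matrix_repD(3)[OF r] that zc Z_comm[OF z] by metis
  then obtain c where "\<rho> z = c \<cdot>\<^sub>m 1\<^sub>m d" using schur_scalar[OF irr matrix_repD(1)[OF r zc]] by metis
  then show ?thesis using central_char_eqI[OF d z] by simp
qed

lemma central_char_linear:
  assumes irr: "irreducible_rep G d \<rho>"
  shows "central_char \<rho> \<in> linear_chars H"
proof -
  have d: "d > 0" and r: "matrix_rep G d \<rho>" using irr unfolding irreducible_rep_iff by auto
  note D = matrix_repD[OF r] and sc = rep_center_scalar[OF irr]
  have "central_char \<rho> \<one> = 1" using d D(2) by (simp add: central_char_def)
  moreover have "central_char \<rho> (x \<otimes> y) = central_char \<rho> x * central_char \<rho> y"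
    if x: "x \<in> Z" and y: "y \<in> Z" for x y
  proof -
    have "\<rho> (x \<otimes> y) = \<rho> x * \<rho> y" using D(3) x y by simp
    also have "\<dots> = (central_char \<rho> x \<cdot>\<^sub>m 1\<^sub>m d) * (central_char \<rho> y \<cdot>\<^sub>m 1\<^sub>m d)"
      using sc[OF x] sc[OF y] by simp
    also have "\<dots> = (central_char \<rho> x * central_char \<rho> y) \<cdot>\<^sub>m 1\<^sub>m d"
      by (subst mult_smult_assoc_mat[of _ d d _ d]) (auto intro!: eq_matI)
    finally show ?thesis using central_char_eqI[OF d] x y by simp
  qed
  ultimately show ?thesis by (auto simp: linear_chars_def central_char_def)
qed

text \<open>Commutators are central and act trivially, so all matrices of \<rho> commute with each
  other and are scalar by Schur.\<close>

lemma rep_trivial_central_char: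
  assumes irr: "irreducible_rep G d \<rho>" and triv: "central_char \<rho> = triv"
  shows "rep_character G \<rho> \<in> linear_chars G"
proof -
  have r: "matrix_rep G d \<rho>" using irr unfolding irreducible_rep_iff by auto
  note D = matrix_repD[OF r]
  have "\<exists>c. \<rho> g = c \<cdot>\<^sub>m 1\<^sub>m d" if g: "g \<in> carrier G" for g
  proof -
    have "\<rho> h * \<rho> g = \<rho> g * \<rho> h" if h: "h \<in> carrier G" for h
    proof -
      obtain z where z: "z \<in> Z" "h \<otimes> g = z \<otimes> (g \<otimes> h)" using commute_up_to_Z[OF h g] .
      have "\<rho> z = 1\<^sub>m d"
        using rep_center_scalar[OF irr z(1)] z(1) by (auto simp: triv triv_def)
      then have "\<rho> (h \<otimes> g) = \<rho> (g \<otimes> h)"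
        using D(1,3) z g h by (metis Z.mem_carrier left_mult_one_mat m_closed)
      then show ?thesis using D(3) g h by simp
    qed
    then show ?thesis using schur_scalar[OF irr D(1)[OF g]] by metis
  qed
  then have "d = 1" by (rule irreducible_rep_all_scalar[OF irr])
  then show ?thesis using irreducible_rep_one_dim irr by simp
qed

lemma rep_nontrivial_central_char:
  assumes irr: "irreducible_rep G d \<rho>" and nontriv: "central_char \<rho> \<noteq> triv"
  shows "rep_character G \<rho> = ext_char (central_char \<rho>)"
proof -
  let ?\<omega> = "central_char \<rho>"
  have d: "d > 0" and r: "matrix_rep G d \<rho>" using irr unfolding irreducible_rep_iff by auto
  note D = matrix_repD[OF r] and \<omega> = central_char_linear[OF irr]
  have on_Z: "mat_trace (\<rho> z) = of_nat d * ?\<omega> z" if "z \<in> Z" for z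
    using rep_center_scalar[OF irr that] mat_trace_scalar by metis
  have off_Z: "mat_trace (\<rho> x) = 0" if x: "x \<in> carrier G" "x \<notin> Z" for x
  proof -
    obtain g where g: "g \<in> carrier G" "g \<otimes> x \<noteq> x \<otimes> g" using x group_centerI by metis
    obtain z where z: "z \<in> Z" "g \<otimes> x = z \<otimes> (x \<otimes> g)" using commute_up_to_Z[OF g(1) x(1)] .
    have "z \<noteq> \<one>" using z g x by auto
    then have \<omega>z: "?\<omega> z \<noteq> 1" using faithful_if_nontrivial[OF \<omega> nontriv z(1)] by simp
    have "g \<otimes> x \<otimes> inv g = z \<otimes> x" using z g x by (simp add: m_assoc)
    \<comment> \<open>Conjugation invariance gives tr \<rho>(x) = \<omega>(z) tr \<rho>(x) with
      \<omega>(z) different from 1, so the trace is 0.\<close>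
    then have "mat_trace (\<rho> x) = mat_trace (\<rho> (z \<otimes> x))" using rep_trace_conj[OF r g(1) x(1)] by simp
    also have "\<rho> (z \<otimes> x) = ?\<omega> z \<cdot>\<^sub>m \<rho> x"
      using D(3)[OF _ x(1), of z] rep_center_scalar[OF irr z(1)] z(1) D(1)[OF x(1)]
      by (simp add: mult_smult_assoc_mat[of _ d d _ d])
    also have "mat_trace \<dots> = ?\<omega> z * mat_trace (\<rho> x)" using mat_trace_smult[OF D(1)[OF x(1)]] .
    finally show ?thesis using \<omega>z by simp
  qed
  have "of_nat (Coset.order G) = (\<Sum>g \<in> carrier G. mat_trace (\<rho> g) * mat_trace (\<rho> (inv g)))"
    using irreducible_character_norm[OF fin irr] by simp
  also have "\<dots> = (\<Sum>z \<in> Z. mat_trace (\<rho> z) * mat_trace (\<rho> (inv z)))"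
    by (rule sum.mono_neutral_right) (use fin Z.subset off_Z in auto)
  \<comment> \<open>On the centre the factors \<omega>(z) and \<omega>(z^-1) cancel. The norm thus
    reads p d^2 = p^(2n + 1), which determines d.\<close>
  also have "\<dots> = (\<Sum>z \<in> Z. of_nat d * of_nat d)"
  proof (rule sum.cong[OF refl])
    fix z assume z: "z \<in> Z"
    have "?\<omega> z * ?\<omega> (inv z) = 1"
      using linear_charsD(2,3)[OF \<omega>] z by simp (metis Z.m_inv_closed Z.mem_carrier r_inv)
    then show "mat_trace (\<rho> z) * mat_trace (\<rho> (inv z)) = of_nat d * of_nat d"
      using on_Z[OF z] on_Z[of "inv z"] z by (simp add: mult.assoc mult.left_commute[of "?\<omega> z"])
  qed
  also have "\<dots> = of_nat (p * (d * d))" by (simp add: card_Z)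
  finally have "p ^ (2 * n + 1) = p * (d * d)" unfolding order of_nat_eq_iff .
  then have "d ^ 2 = (p ^ n) ^ 2" using p_pos by (simp add: power2_eq_square power_mult power_add mult_2)
  then have "d = p ^ n" by (simp add: power2_eq_iff_nonneg)
  then show ?thesis
    using on_Z off_Z by (auto simp: rep_character_def ext_char_def fun_eq_iff restrict_def)
qed

text \<open>It is enough to prescribe the scalar at one nontrivial z of the centre: that value is a
  root of unity of order dividing \<open>ord z\<close>, and it determines \<omega> entirely.\<close>

lemma exists_rep_central_char:
  assumes \<omega>: "\<omega> \<in> linear_chars H" and nontriv: "\<omega> \<noteq> triv"
  obtains d \<rho> where "irreducible_rep G d \<rho>" "central_char \<rho> = \<omega>"
proof -
  have "1 < card Z" using card_Z prime_gt_1_nat[OF prime_p] by simp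
  then obtain z where z: "z \<in> Z" "z \<noteq> \<one>"
    by (metis card_le_Suc0_iff_eq fin_Z Z.one_closed One_nat_def not_le)
  have zc: "z \<in> carrier G" using z by simp
  have "\<omega> z ^ ord z = 1"
    using H.linear_char_pow[OF \<omega>, of z "ord z"] z(1) zc linear_charsD(2)[OF \<omega>]
    by (simp add: H_pow)
  then obtain d \<rho> where irr: "irreducible_rep G d \<rho>" and \<rho>z: "\<rho> z = \<omega> z \<cdot>\<^sub>m 1\<^sub>m d"
    using exists_irreducible_rep_scalar[OF fin zc Z_comm[OF z(1)]] by blast
  have "d > 0" using irr unfolding irreducible_rep_iff by auto
  then have "central_char \<rho> z = \<omega> z" using central_char_eqI[of d z \<rho> "\<omega> z"] z(1) \<rho>z by simp
  then have "central_char \<rho> = \<omega>"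
    using linear_char_H_eqI[OF central_char_linear[OF irr] \<omega> z] by simp
  then show ?thesis using irr that by blast
qed

lemma Irr_eq: "Irr G = linear_chars G \<union> ext_char ` (linear_chars H - {triv})"
proof
  show "Irr G \<subseteq> linear_chars G \<union> ext_char ` (linear_chars H - {triv})"
  proof
    fix \<chi> assume "\<chi> \<in> Irr G"
    then obtain d \<rho> where \<rho>: "irreducible_rep G d \<rho>" "\<chi> = rep_character G \<rho>"
      unfolding Irr_def by auto
    show "\<chi> \<in> linear_chars G \<union> ext_char ` (linear_chars H - {triv})"
    proof (cases "central_char \<rho> = triv")
      case True
      then show ?thesis using rep_trivial_central_char \<rho> by blast
    next
      case False
      then show ?thesis
        using rep_nontrivial_central_char[OF \<rho>(1)] central_char_linear[OF \<rho>(1)] \<rho>(2) by blast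
    qed
  qed
  have "ext_char \<omega> \<in> Irr G" if \<omega>: "\<omega> \<in> linear_chars H" "\<omega> \<noteq> triv" for \<omega>
  proof -
    obtain d \<rho> where "irreducible_rep G d \<rho>" "central_char \<rho> = \<omega>"
      using exists_rep_central_char[OF \<omega>] .
    then have "irreducible_rep G d \<rho>" "ext_char \<omega> = rep_character G \<rho>"
      using rep_nontrivial_central_char \<omega>(2) by auto
    then show ?thesis unfolding Irr_def by blast
  qed
  then show "linear_chars G \<union> ext_char ` (linear_chars H - {triv}) \<subseteq> Irr G"
    using linear_chars_subset_Irr by auto
qed

section \<open>Evaluation of the kernel\<close>

text \<open>The two families are disjoint, as linear characters have modulus 1 at a noncentral
  element where every \<open>ext_char\<close> vanishes. No repetition occurs in the second family,
  since \<omega> is recovered by dividing by \<open>p ^ n\<close>.\<close>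

lemma Irr_sum:
  "(\<Sum>\<chi> \<in> Irr G. f \<chi>) =
     (\<Sum>\<phi> \<in> linear_chars G. f \<phi>) + (\<Sum>\<omega> \<in> linear_chars H - {triv}. f (ext_char \<omega>))"
proof -
  obtain x y where "x \<in> carrier G" "y \<in> carrier G" "x \<otimes> y \<noteq> y \<otimes> x" by (rule exists_noncommuting)
  then have x: "x \<in> carrier G" "x \<notin> Z" using Z_comm by metis+
  have "ext_char \<omega> \<notin> linear_chars G" for \<omega>
  proof
    assume "ext_char \<omega> \<in> linear_chars G"
    then have "cmod (ext_char \<omega> x) = 1" using norm_linear_char[OF fin] x by blast
    then show False using x by (simp add: ext_char_def)
  qed
  then have disj: "linear_chars G \<inter> ext_char ` (linear_chars H - {triv}) = {}" by auto
  have "inj_on ext_char (linear_chars H)"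
  proof
    fix \<omega> \<omega>' assume \<omega>: "\<omega> \<in> linear_chars H" and \<omega>': "\<omega>' \<in> linear_chars H"
      and eq: "ext_char \<omega> = ext_char \<omega>'"
    show "\<omega> = \<omega>'"
    proof (rule extensionalityI[where A = Z])
      fix z assume "z \<in> Z"
      then show "\<omega> z = \<omega>' z" using fun_cong[OF eq, of z] p_pos by (simp add: ext_char_def)
    qed (use linear_charsD(1)[OF \<omega>] linear_charsD(1)[OF \<omega>'] in simp_all)
  qed
  then have inj: "inj_on ext_char (linear_chars H - {triv})" by (rule inj_on_diff)
  have "finite (linear_chars G)" "finite (linear_chars H)"
    using finite_linear_chars[OF fin] H.finite_linear_chars fin_Z by auto
  then show ?thesis
    unfolding Irr_eq by (subst sum.union_disjoint) (use disj inj in \<open>auto simp: sum.reindex\<close>)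
qed

text \<open>The linear characters see only whether x and y share a coset of the centre, which gives
  the term p^(2n). The others contribute on the centre alone, as the column sum over all \<omega>
  less the missing trivial one; this is the origin of the -1.\<close>

lemma kernel_formula:
  assumes x: "x \<in> carrier G" and y: "y \<in> carrier G"
  shows "(\<Sum>\<chi> \<in> Irr G. (char_degree G \<chi>)\<^sup>2 * \<chi> x * cnj (\<chi> y)) =
     of_real ((if x \<otimes> inv y \<in> Z then real p ^ (2 * n) else 0) +
       (if x \<in> Z \<and> y \<in> Z then real p ^ (4 * n) * ((if x = y then real p else 0) - 1) else 0))"
proof -
  have "(\<Sum>\<phi> \<in> linear_chars G. (char_degree G \<phi>)\<^sup>2 * \<phi> x * cnj (\<phi> y))
      = (\<Sum>\<phi> \<in> linear_chars G. \<phi> (x \<otimes> inv y))"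
    using x y linear_char_inv[OF fin]
    by (intro sum.cong refl) (simp add: char_degree_def linear_charsD)
  also have "\<dots> = (if x \<otimes> inv y \<in> Z then of_nat (p ^ (2 * n)) else 0)"
    using linear_chars_G_sum x y by simp
  finally have lin: "(\<Sum>\<phi> \<in> linear_chars G. (char_degree G \<phi>)\<^sup>2 * \<phi> x * cnj (\<phi> y)) = \<dots>" .
  have ext: "(\<Sum>\<omega> \<in> linear_chars H - {triv}.
        (char_degree G (ext_char \<omega>))\<^sup>2 * ext_char \<omega> x * cnj (ext_char \<omega> y))
      = (if x \<in> Z \<and> y \<in> Z then of_nat (p ^ (4 * n)) * ((if x = y then of_nat p else 0) - 1) else 0)"
  proof (cases "x \<in> Z \<and> y \<in> Z")
    case False
    then show ?thesis using x y by (auto simp: ext_char_def)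
  next
    case True
    have inv_eq: "inv\<^bsub>H\<^esub> y = inv y" using True by (simp add: Z.subgroup_axioms)
    have "(\<Sum>\<omega> \<in> linear_chars H - {triv}.
        (char_degree G (ext_char \<omega>))\<^sup>2 * ext_char \<omega> x * cnj (ext_char \<omega> y))
      = (\<Sum>\<omega> \<in> linear_chars H - {triv}. of_nat (p ^ (4 * n)) * \<omega> (x \<otimes> inv y))"
    proof (rule sum.cong[OF refl])
      fix \<omega> assume "\<omega> \<in> linear_chars H - {triv}"
      then have \<omega>: "\<omega> \<in> linear_chars H" by simp
      have 1: "\<omega> \<one> = 1" using linear_charsD(2)[OF \<omega>] by simp
      have "\<omega> (x \<otimes> inv y) = \<omega> x * cnj (\<omega> y)"
        using linear_charsD(3)[OF \<omega>, of x "inv y"] H.linear_char_inv[OF _ \<omega>, of y] True fin_Z inv_eq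
        by simp
      \<comment> \<open>Four factors \<open>p ^ n\<close> meet: two from the squared degree and one
        from each character value.\<close>
      moreover have "(of_nat (p ^ n) :: complex) ^ 4 = of_nat (p ^ (4 * n))"
        by (simp add: power_mult[symmetric] mult.commute)
      ultimately show "(char_degree G (ext_char \<omega>))\<^sup>2 * ext_char \<omega> x * cnj (ext_char \<omega> y)
          = of_nat (p ^ (4 * n)) * \<omega> (x \<otimes> inv y)"
        using True 1 x y by (simp add: char_degree_def ext_char_def eval_nat_numeral algebra_simps)
    qed
    also have "\<dots> = of_nat (p ^ (4 * n)) * ((\<Sum>\<omega> \<in> linear_chars H. \<omega> (x \<otimes> inv y)) - 1)"
    proof -
      have "triv (x \<otimes> inv y) = 1" using True by (simp add: triv_def)
      then show ?thesis
        using triv_linear_char H.finite_linear_chars fin_Z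
        by (simp add: sum_distrib_left[symmetric] sum_diff1)
    qed
    also have "x \<otimes> inv y = \<one> \<longleftrightarrow> x = y" using x y by (metis inv_equality inv_inv inv_closed r_inv)
    then have "(\<Sum>\<omega> \<in> linear_chars H. \<omega> (x \<otimes> inv y)) = (if x = y then of_nat p else 0)"
      using linear_chars_H_sum[of "x \<otimes> inv y"] True by simp
    finally show ?thesis using True by simp
  qed
  show ?thesis unfolding Irr_sum lin ext by simp
qed

end

section \<open>The amenability constant\<close>

lemma (in group) Irr_conj:
  assumes "\<chi> \<in> Irr G" "g \<in> carrier G" "x \<in> carrier G"
  shows "\<chi> (g \<otimes> x \<otimes> inv g) = \<chi> x"
  using assms rep_trace_conj by (auto simp: Irr_def irreducible_rep_iff rep_character_def)

lemma (in group) Conj_eq: "Conj G = (\<lambda>x. (\<lambda>g. g \<otimes> x \<otimes> inv g) ` carrier G) ` carrier G"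
  by (auto simp: Conj_def orbits_def orbit_def)

lemma (in group) class_value_eq:
  assumes \<chi>: "\<chi> \<in> Irr G" and C: "C \<in> Conj G" and x: "x \<in> C"
  shows "class_value \<chi> C = \<chi> x"
proof -
  obtain y where y: "y \<in> carrier G" "C = (\<lambda>g. g \<otimes> y \<otimes> inv g) ` carrier G"
    using C unfolding Conj_eq by blast
  have "\<chi> z = \<chi> y" if "z \<in> C" for z using that y Irr_conj[OF \<chi>] by auto
  then have "\<forall>z \<in> C. \<chi> z = \<chi> x" using x by simp
  then show ?thesis unfolding class_value_def using x by (intro the_equality) metis+
qed

text \<open>The classes partition the group, so the weight \<open>card C\<close> repeats the common
  value once per element.\<close>

lemma (in group) sum_Conj:
  fixes F :: "'a set \<Rightarrow> real"
  assumes fin: "finite (carrier G)" and F: "\<And>C x. C \<in> Conj G \<Longrightarrow> x \<in> C \<Longrightarrow> F C = f x"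
  shows "(\<Sum>C \<in> Conj G. F C * real (card C)) = (\<Sum>x \<in> carrier G. f x)"
proof -
  have "(\<Sum>C \<in> Conj G. F C * real (card C)) = (\<Sum>C \<in> Conj G. \<Sum>x \<in> C. f x)"
  proof (rule sum.cong[OF refl])
    fix C assume "C \<in> Conj G"
    then have "(\<Sum>x \<in> C. f x) = (\<Sum>x \<in> C. F C)" using F by (intro sum.cong) auto
    then show "F C * real (card C) = (\<Sum>x \<in> C. f x)" by simp
  qed
  also have "\<dots> = (\<Sum>x \<in> carrier G. f x)"
    unfolding Conj_def by (rule group_action.disjoint_sum[OF action_by_conjugation fin])
  finally show ?thesis .
qed

lemma (in group) AM_Z_as_sum_over_elements:
  assumes fin: "finite (carrier G)"
  shows "AM_Z G = 1 / (real (Coset.order G))\<^sup>2 * (\<Sum>x \<in> carrier G. \<Sum>y \<in> carrier G.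
           cmod (\<Sum>\<chi> \<in> Irr G. (char_degree G \<chi>)\<^sup>2 * \<chi> x * cnj (\<chi> y)))"
proof -
  define K where "K = (\<lambda>x y. cmod (\<Sum>\<chi> \<in> Irr G. (char_degree G \<chi>)\<^sup>2 * \<chi> x * cnj (\<chi> y)))"
  define S where "S = (\<lambda>C D. cmod (\<Sum>\<chi> \<in> Irr G.
      (char_degree G \<chi>)\<^sup>2 * class_value \<chi> C * cnj (class_value \<chi> D)))"
  have S: "S C D = K x y" if "C \<in> Conj G" "x \<in> C" "D \<in> Conj G" "y \<in> D" for C D x y
    unfolding S_def K_def using that class_value_eq
    by (intro arg_cong[where f = cmod] sum.cong refl) auto
  \<comment> \<open>Regrouped so that \<open>sum_Conj\<close> applies to D for each fixed C and then
    to C.\<close>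
  have "(\<Sum>C \<in> Conj G. \<Sum>D \<in> Conj G. S C D * real (card C) * real (card D))
      = (\<Sum>C \<in> Conj G. (\<Sum>D \<in> Conj G. S C D * real (card D)) * real (card C))"
    by (simp add: sum_distrib_left sum_distrib_right mult_ac)
  also have "\<dots> = (\<Sum>x \<in> carrier G. \<Sum>y \<in> carrier G. K x y)"
  proof (rule sum_Conj[OF fin])
    show "(\<Sum>D \<in> Conj G. S C D * real (card D)) = (\<Sum>y \<in> carrier G. K x y)"
      if "C \<in> Conj G" "x \<in> C" for C x
      using S that by (intro sum_Conj[OF fin]) auto
  qed
  finally show ?thesis unfolding AM_Z_def S_def K_def by simp
qed

context extraspecial_group
begin

text \<open>A noncentral row has p entries p^(2n), on the coset of x. A central row has the diagonal
  entry p^(2n) + p^(4n)(p - 1) and p - 1 further entries of absolute value p^(4n) - p^(2n).\<close>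

lemma kernel_row_sum:
  assumes x: "x \<in> carrier G"
  shows "(\<Sum>y \<in> carrier G. cmod (\<Sum>\<chi> \<in> Irr G. (char_degree G \<chi>)\<^sup>2 * \<chi> x * cnj (\<chi> y)))
    = (if x \<in> Z then 2 * (real p - 1) * real p ^ (4 * n) - (real p - 2) * real p ^ (2 * n)
       else real p * real p ^ (2 * n))"
proof -
  let ?K = "\<lambda>y. cmod (\<Sum>\<chi> \<in> Irr G. (char_degree G \<chi>)\<^sup>2 * \<chi> x * cnj (\<chi> y))"
  have p1: "real p \<ge> 1" using p_pos by simp
  show ?thesis
  proof (cases "x \<in> Z")
    case False
    have K: "?K y = (if y \<in> Z #> x then real p ^ (2 * n) else 0)" if y: "y \<in> carrier G" for y
    proof -
      have "x \<otimes> inv y \<in> Z \<longleftrightarrow> y \<otimes> inv x \<in> Z"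
        using x y Z.m_inv_closed[of "x \<otimes> inv y"] Z.m_inv_closed[of "y \<otimes> inv x"]
        by (auto simp: inv_mult_group)
      also have "\<dots> \<longleftrightarrow> y \<in> Z #> x" using Z.rcos_module[OF is_group x y] by simp
      finally show ?thesis unfolding kernel_formula[OF x y] norm_of_real using False by simp
    qed
    have "card (Z #> x) = p"
      using card_rcosets_equal[OF rcosetsI[OF Z.subset x] Z.subset] card_Z by simp
    moreover have "Z #> x \<subseteq> carrier G" using r_coset_subset_G[OF Z.subset x] .
    ultimately have "(\<Sum>y \<in> carrier G. ?K y) = real p * real p ^ (2 * n)"
      using fin by (simp add: K sum.If_cases Int_absorb1)
    then show ?thesis using False by simp
  next
    case True
    have K: "?K y = (if y \<in> Z then if y = x then real p ^ (2 * n) + real p ^ (4 * n) * (real p - 1)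
        else real p ^ (4 * n) - real p ^ (2 * n) else 0)" if y: "y \<in> carrier G" for y
    proof -
      have "x \<otimes> inv y \<in> Z \<longleftrightarrow> y \<in> Z"
      proof
        assume "x \<otimes> inv y \<in> Z"
        then have "inv (x \<otimes> inv y) \<otimes> x \<in> Z" using True by blast
        then show "y \<in> Z" using x y by (simp add: inv_mult_group m_assoc)
      qed (use True in auto)
      \<comment> \<open>This settles the sign of the off-diagonal entry p^(2n) - p^(4n), whose
        absolute value is its negative.\<close>
      moreover have "real p ^ (2 * n) \<le> real p ^ (4 * n)" using p1 by (intro power_increasing) auto
      moreover have "0 \<le> real p ^ (2 * n) + real p ^ (4 * n) * (real p - 1)" using p1 by simp
      ultimately show ?thesis unfolding kernel_formula[OF x y] norm_of_real using True by simp
    qed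
    have "(\<Sum>y \<in> carrier G. ?K y) = (\<Sum>y \<in> Z.
        if y = x then real p ^ (2 * n) + real p ^ (4 * n) * (real p - 1)
        else real p ^ (4 * n) - real p ^ (2 * n))"
      using fin Z.subset by (simp add: K sum.If_cases Int_absorb1 cong: sum.cong)
    also have "\<dots> = real p ^ (2 * n) + real p ^ (4 * n) * (real p - 1)
        + (\<Sum>y \<in> Z - {x}. real p ^ (4 * n) - real p ^ (2 * n))"
      using fin_Z True by (subst sum.remove[OF _ True]) (auto intro!: sum.cong)
    also have "(\<Sum>y \<in> Z - {x}. real p ^ (4 * n) - real p ^ (2 * n))
        = (real p - 1) * (real p ^ (4 * n) - real p ^ (2 * n))"
      using fin_Z True card_Z p_pos by (simp add: of_nat_diff)
    finally show ?thesis using True by (simp add: algebra_simps)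
  qed
qed

lemma AM_Z_eq: "AM_Z G = 1 + 2 * (1 - 1 / real p ^ (2 * n)) * (1 - 1 / real p)"
proof -
  \<comment> \<open>\<open>q\<close> is the index of the centre. There are p central rows and pq - p
    noncentral ones, and |G| = pq.\<close>
  define q where "q = real p ^ (2 * n)"
  have q: "q > 0" and p: "real p > 0" using p_pos by (auto simp: q_def)
  have q2: "real p ^ (4 * n) = q\<^sup>2" by (simp add: q_def flip: power_mult)
  have ord: "real (Coset.order G) = real p * q" by (simp add: order q_def)
  have "card (carrier G - Z) = Coset.order G - p"
    using card_Diff_subset[OF fin_Z Z.subset] by (simp add: Coset.order_def card_Z)
  moreover have "p \<le> Coset.order G" using card_mono[OF fin Z.subset] by (simp add: Coset.order_def card_Z)
  ultimately have off: "real (card (carrier G - Z)) = real p * q - real p" using ord by (simp add: of_nat_diff)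
  have "(\<Sum>x \<in> carrier G. \<Sum>y \<in> carrier G.
           cmod (\<Sum>\<chi> \<in> Irr G. (char_degree G \<chi>)\<^sup>2 * \<chi> x * cnj (\<chi> y)))
      = (\<Sum>x \<in> carrier G. if x \<in> Z then 2 * (real p - 1) * q\<^sup>2 - (real p - 2) * q else real p * q)"
    by (intro sum.cong refl) (simp add: kernel_row_sum q2 flip: q_def)
  also have "\<dots> = real p * (2 * (real p - 1) * q\<^sup>2 - (real p - 2) * q) + (real p * q - real p) * (real p * q)"
    using fin Z.subset off by (simp add: sum.If_cases Int_absorb1 card_Z Diff_eq flip: Compl_eq)
  finally show ?thesis
    unfolding AM_Z_as_sum_over_elements[OF fin] ord q_def[symmetric]
    using p q by (simp add: field_simps power2_eq_square)
qed

end

theorem mainTheorem4: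
  fixes G :: "('a, 'b) monoid_scheme" and p n :: nat
  assumes "Factorial_Ring.prime p"
    and "p_extraspecial p G"
    and "Coset.order G = p ^ (2 * n + 1)"
  shows "AM_Z G = 1 + 2 * (1 - 1 / real p ^ (2 * n)) * (1 - 1 / real p)"
proof -
  interpret group G using assms(2) by (simp add: p_extraspecial_def)
  interpret extraspecial_group G p n using assms by unfold_locales
  show ?thesis by (rule AM_Z_eq)
qed

end
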